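(* Let $X$ and $Y$ be freely independent, let $\mathcal{K}$ be the corresponding transition operator, and let $\nu$ be the probability measure such that $G_{X+Y}(z)=G_X(F_\nu(z))$, so that $$\mathcal{K}[f](x)=\int_{\mathbb{R}}f(y)\,d(\delta_x\triangleright\nu)(y).$$ Then $\mathcal{K}$ is a contraction on each $L^p(\mathbb{R},dx)$, $1\le p\le\infty$.
   Context: For a probability measure $\mu$ on $\mathbb{R}$, $G_\mu(z)=\int_{\mathbb{R}}\frac{1}{z-x}\,d\mu(x)$ for $z\in\mathbb{C}\setminus\mathbb{R}$ and $F_\mu=1/G_\mu$. For a self-adjoint random variable $X$, $G_X$ denotes the Cauchy transform of its distribution. Monotone convolution $\triangleright$ is determined by $F_{\mu_1\triangleright\mu_2}(z)=F_{\mu_1}(F_{\mu_2}(z))$; thus $\delta_x\triangleright\nu$ is the probability measure with $F_{\delta_x\triangleright\nu}(z)=F_\nu(z)-x$. By a theorem of Biane, for freely independent $X,Y$ the transition operator $\mathcal{K}$, defined via $\mathbb{E}[f(X+Y)|X]=(\mathcal{K}f)(X)$, is the map determined by $\mathcal{K}\left[\frac{1}{z-x}\right]=\frac{1}{F_\nu(z)-x}$ for $z\in\mathbb{C}\setminus\mathbb{R}$, where $\nu$ is the unique probability measure with $G_{X+Y}(z)=G_X(F_\nu(z))$. *)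

theory Defs
  imports "HOL-Probability.Probability"
begin

text \<open>Complex Hilbert spaces. The scalar product is linear in its first argument; the norm and
  the topology are those of the underlying real Hilbert space, by \<open>inner_eq_Re_cinner\<close>.\<close>

class complex_hilbert_space = real_inner + complete_space +
  fixes scaleC :: "complex \<Rightarrow> 'a \<Rightarrow> 'a" (infixr "*\<^sub>C" 75)
    and cinner :: "'a \<Rightarrow> 'a \<Rightarrow> complex"
  assumes scaleC_add_right: "c *\<^sub>C (x + y) = c *\<^sub>C x + c *\<^sub>C y"
    and scaleC_add_left: "(c + d) *\<^sub>C x = c *\<^sub>C x + d *\<^sub>C x"
    and scaleC_scaleC: "c *\<^sub>C (d *\<^sub>C x) = (c * d) *\<^sub>C x"
    and scaleC_of_real: "complex_of_real r *\<^sub>C x = r *\<^sub>R x"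
    and cinner_add_left: "cinner (x + y) w = cinner x w + cinner y w"
    and cinner_scaleC_left: "cinner (c *\<^sub>C x) w = c * cinner x w"
    and cinner_commute: "cinner x w = cnj (cinner w x)"
    and inner_eq_Re_cinner: "inner x w = Re (cinner x w)"


section \<open>Bounded operators and tracial von Neumann algebras\<close>

definition bounded_op :: "('h::complex_hilbert_space \<Rightarrow> 'h) \<Rightarrow> bool" where
  "bounded_op A \<longleftrightarrow> bounded_linear A \<and> (\<forall>c x. A (c *\<^sub>C x) = c *\<^sub>C A x)"

definition op_adjoint :: "('h::complex_hilbert_space \<Rightarrow> 'h) \<Rightarrow> ('h \<Rightarrow> 'h)" where
  "op_adjoint A = (THE B. \<forall>x y. cinner (A x) y = cinner x (B y))"

definition op_selfadjoint :: "('h::complex_hilbert_space \<Rightarrow> 'h) \<Rightarrow> bool" where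
  "op_selfadjoint A \<longleftrightarrow> (\<forall>x y. cinner (A x) y = cinner x (A y))"

definition op_le :: "('h::complex_hilbert_space \<Rightarrow> 'h) \<Rightarrow> ('h \<Rightarrow> 'h) \<Rightarrow> bool" where
  "op_le A B \<longleftrightarrow> op_selfadjoint A \<and> op_selfadjoint B \<and>
     (\<forall>x. Re (cinner (A x) x) \<le> Re (cinner (B x) x))"

definition op_projection :: "('h::complex_hilbert_space \<Rightarrow> 'h) \<Rightarrow> bool" where
  "op_projection P \<longleftrightarrow> bounded_op P \<and> op_selfadjoint P \<and> P \<circ> P = P"

definition commutant :: "('h::complex_hilbert_space \<Rightarrow> 'h) set \<Rightarrow> ('h \<Rightarrow> 'h) set" where
  "commutant S = {T. bounded_op T \<and> (\<forall>A\<in>S. T \<circ> A = A \<circ> T)}"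

definition von_neumann_algebra :: "('h::complex_hilbert_space \<Rightarrow> 'h) set \<Rightarrow> bool" where
  "von_neumann_algebra M \<longleftrightarrow>
     (\<forall>A\<in>M. bounded_op A \<and> op_adjoint A \<in> M) \<and> commutant (commutant M) = M"

text \<open>\<open>op_sup M D S\<close>: \<open>S\<close> is the supremum of \<open>D\<close> among the self-adjoint elements of \<open>M\<close>.\<close>

definition op_sup ::
  "('h::complex_hilbert_space \<Rightarrow> 'h) set \<Rightarrow> ('h \<Rightarrow> 'h) set \<Rightarrow> ('h \<Rightarrow> 'h) \<Rightarrow> bool" where
  "op_sup M D S \<longleftrightarrow> S \<in> M \<and> (\<forall>A\<in>D. op_le A S) \<and>
     (\<forall>T\<in>M. (\<forall>A\<in>D. op_le A T) \<longrightarrow> op_le S T)"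

text \<open>A von Neumann algebra with a faithful normal tracial state; normality is preservation of
  suprema of bounded upward directed sets of self-adjoint elements.\<close>

locale wstar_probability_space =
  fixes M :: "('h::complex_hilbert_space \<Rightarrow> 'h) set"
    and \<tau> :: "('h \<Rightarrow> 'h) \<Rightarrow> complex"
  assumes vna: "von_neumann_algebra M"
    and state_add: "\<And>A B. A \<in> M \<Longrightarrow> B \<in> M \<Longrightarrow> \<tau> (\<lambda>x. A x + B x) = \<tau> A + \<tau> B"
    and state_scale: "\<And>c A. A \<in> M \<Longrightarrow> \<tau> (\<lambda>x. c *\<^sub>C A x) = c * \<tau> A"
    and state_id: "\<tau> id = 1"
    and state_positive: "\<And>A. A \<in> M \<Longrightarrow> Im (\<tau> (op_adjoint A \<circ> A)) = 0 \<and> 0 \<le> Re (\<tau> (op_adjoint A \<circ> A))"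
    and state_faithful: "\<And>A. A \<in> M \<Longrightarrow> \<tau> (op_adjoint A \<circ> A) = 0 \<Longrightarrow> A = (\<lambda>x. 0)"
    and state_tracial: "\<And>A B. A \<in> M \<Longrightarrow> B \<in> M \<Longrightarrow> \<tau> (A \<circ> B) = \<tau> (B \<circ> A)"
    and state_normal: "\<And>D S. D \<subseteq> M \<Longrightarrow> D \<noteq> {} \<Longrightarrow>
          (\<And>A B. A \<in> D \<Longrightarrow> B \<in> D \<Longrightarrow> \<exists>C\<in>D. op_le A C \<and> op_le B C) \<Longrightarrow>
          op_sup M D S \<Longrightarrow> Re (\<tau> S) = (SUP A\<in>D. Re (\<tau> A))"


section \<open>Self-adjoint random variables\<close>

text \<open>A random variable is a possibly unbounded operator, represented by its graph.\<close>

definition graph_adjoint :: "('h::complex_hilbert_space \<times> 'h) set \<Rightarrow> ('h \<times> 'h) set" where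
  "graph_adjoint X = {(u, v). \<forall>(x, y)\<in>X. cinner y u = cinner x v}"

definition selfadjoint_operator :: "('h::complex_hilbert_space \<times> 'h) set \<Rightarrow> bool" where
  "selfadjoint_operator X \<longleftrightarrow>
     single_valued X \<and> closure (Domain X) = UNIV \<and> graph_adjoint X = X"

text \<open>Every bounded \<open>T\<close> in the commutant of \<open>M\<close> satisfies \<open>T X \<subseteq> X T\<close>.\<close>

definition affiliated :: "('h::complex_hilbert_space \<Rightarrow> 'h) set \<Rightarrow> ('h \<times> 'h) set \<Rightarrow> bool" where
  "affiliated M X \<longleftrightarrow> (\<forall>T\<in>commutant M. \<forall>(x, y)\<in>X. (T x, T y) \<in> X)"

definition selfadjoint_rv :: "('h::complex_hilbert_space \<Rightarrow> 'h) set \<Rightarrow> ('h \<times> 'h) set \<Rightarrow> bool" where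
  "selfadjoint_rv M X \<longleftrightarrow> selfadjoint_operator X \<and> affiliated M X"

text \<open>The sum of random variables is the strong sum: the closure of the pointwise sum on the
  intersection of the domains. For self-adjoint operators affiliated with a finite von Neumann
  algebra it is again self-adjoint and affiliated.\<close>

definition rv_add ::
  "('h::complex_hilbert_space \<times> 'h) set \<Rightarrow> ('h \<times> 'h) set \<Rightarrow> ('h \<times> 'h) set" where
  "rv_add X Y = closure {(x, y + z) |x y z. (x, y) \<in> X \<and> (x, z) \<in> Y}"

definition generated_vna :: "('h::complex_hilbert_space \<times> 'h) set \<Rightarrow> ('h \<Rightarrow> 'h) set" where
  "generated_vna X = \<Inter>{N. von_neumann_algebra N \<and> affiliated N X}"

definition projection_valued_measure :: "(real set \<Rightarrow> ('h::complex_hilbert_space \<Rightarrow> 'h)) \<Rightarrow> bool" where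
  "projection_valued_measure E \<longleftrightarrow>
     (\<forall>B\<in>sets borel. op_projection (E B)) \<and> E UNIV = id \<and>
     (\<forall>B\<in>sets borel. \<forall>C\<in>sets borel. E (B \<inter> C) = E B \<circ> E C) \<and>
     (\<forall>B x. range B \<subseteq> sets borel \<longrightarrow> disjoint_family B \<longrightarrow>
        (\<lambda>n::nat. E (B n) x) sums E (\<Union>n. B n) x)"

text \<open>The measure \<open>B \<mapsto> \<langle>E(B)x, x\<rangle> = \<parallel>E(B)x\<parallel>\<^sup>2\<close>.\<close>

definition vector_measure :: "(real set \<Rightarrow> ('h::complex_hilbert_space \<Rightarrow> 'h)) \<Rightarrow> 'h \<Rightarrow> real measure" where
  "vector_measure E x = measure_of UNIV (sets borel) (\<lambda>B. ennreal ((norm (E B x))\<^sup>2))"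

text \<open>\<open>X = \<integral>t dE(t)\<close>: equality of the domains and of the quadratic forms, which by polarization
  is equality of operators.\<close>

definition spectral_resolution ::
  "('h::complex_hilbert_space \<times> 'h) set \<Rightarrow> (real set \<Rightarrow> ('h \<Rightarrow> 'h)) \<Rightarrow> bool" where
  "spectral_resolution X E \<longleftrightarrow> projection_valued_measure E \<and>
     Domain X = {x. integrable (vector_measure E x) (\<lambda>t. t\<^sup>2)} \<and>
     (\<forall>(x, y)\<in>X. cinner y x = complex_of_real (LINT t|vector_measure E x. t))"

definition bounded_borel :: "(real \<Rightarrow> complex) \<Rightarrow> bool" where
  "bounded_borel f \<longleftrightarrow> f \<in> borel_measurable borel \<and> bounded (range f)"

text \<open>\<open>f(X) = \<integral>f dE\<close> for bounded Borel \<open>f\<close>, determined by its quadratic form.\<close>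

definition rv_fun :: "(real \<Rightarrow> complex) \<Rightarrow> ('h::complex_hilbert_space \<times> 'h) set \<Rightarrow> ('h \<Rightarrow> 'h)" where
  "rv_fun f X = (THE A. bounded_op A \<and>
     (\<exists>E. spectral_resolution X E \<and> (\<forall>x. cinner (A x) x = (LINT t|vector_measure E x. f t))))"

definition rv_distribution ::
  "(('h \<Rightarrow> 'h) \<Rightarrow> complex) \<Rightarrow> ('h::complex_hilbert_space \<times> 'h) set \<Rightarrow> real measure" where
  "rv_distribution \<tau> X =
     measure_of UNIV (sets borel) (\<lambda>B. ennreal (Re (\<tau> (rv_fun (indicator B) X))))"


section \<open>Freeness, conditional expectation and transition operators\<close>

definition free_family ::
  "(('h \<Rightarrow> 'h) \<Rightarrow> complex) \<Rightarrow> ('i \<Rightarrow> ('h::complex_hilbert_space \<Rightarrow> 'h) set) \<Rightarrow> bool" where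
  "free_family \<tau> N \<longleftrightarrow>
     (\<forall>n a j. 0 < n \<longrightarrow> (\<forall>k<n. a k \<in> N (j k) \<and> \<tau> (a k) = 0) \<longrightarrow>
        (\<forall>k. Suc k < n \<longrightarrow> j k \<noteq> j (Suc k)) \<longrightarrow>
        \<tau> (foldr (\<circ>) (map a [0..<n]) id) = 0)"

definition freely_independent ::
  "(('h \<Rightarrow> 'h) \<Rightarrow> complex) \<Rightarrow> ('h::complex_hilbert_space \<times> 'h) set \<Rightarrow> ('h \<times> 'h) set \<Rightarrow> bool" where
  "freely_independent \<tau> X Y \<longleftrightarrow>
     free_family \<tau> (\<lambda>b::bool. if b then generated_vna X else generated_vna Y)"

text \<open>Since \<open>\<tau>\<close> is a faithful normal trace, these identities determine the \<open>\<tau>\<close>-preserving conditional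
  expectation of \<open>A\<close> onto the von Neumann subalgebra \<open>N\<close>.\<close>

definition cond_expectation ::
  "(('h \<Rightarrow> 'h) \<Rightarrow> complex) \<Rightarrow> ('h::complex_hilbert_space \<Rightarrow> 'h) set \<Rightarrow> ('h \<Rightarrow> 'h) \<Rightarrow> ('h \<Rightarrow> 'h)" where
  "cond_expectation \<tau> N A = (THE B. B \<in> N \<and> (\<forall>C\<in>N. \<tau> (B \<circ> C) = \<tau> (A \<circ> C)))"

text \<open>\<open>E[f(X+Y) | X] = (K f)(X)\<close> for all bounded Borel functions \<open>f\<close>.\<close>

definition transition_operator ::
  "(('h \<Rightarrow> 'h) \<Rightarrow> complex) \<Rightarrow> ('h::complex_hilbert_space \<times> 'h) set \<Rightarrow> ('h \<times> 'h) set \<Rightarrow>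
   ((real \<Rightarrow> complex) \<Rightarrow> (real \<Rightarrow> complex)) \<Rightarrow> bool" where
  "transition_operator \<tau> X Y K \<longleftrightarrow>
     (\<forall>f. bounded_borel f \<longrightarrow> bounded_borel (K f) \<and>
        cond_expectation \<tau> (generated_vna X) (rv_fun f (rv_add X Y)) = rv_fun (K f) X)"


section \<open>Cauchy transform and monotone convolution\<close>

definition cauchy_transform :: "real measure \<Rightarrow> complex \<Rightarrow> complex" where
  "cauchy_transform \<mu> z = (LINT x|\<mu>. 1 / (z - complex_of_real x))"

definition F_transform :: "real measure \<Rightarrow> complex \<Rightarrow> complex" where
  "F_transform \<mu> z = 1 / cauchy_transform \<mu> z"

definition monotone_convolution :: "real measure \<Rightarrow> real measure \<Rightarrow> real measure" (infixr "\<rhd>" 70) where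
  "\<mu>\<^sub>1 \<rhd> \<mu>\<^sub>2 = (THE \<mu>. real_distribution \<mu> \<and>
     (\<forall>z. z \<notin> \<real> \<longrightarrow> F_transform \<mu> z = F_transform \<mu>\<^sub>1 (F_transform \<mu>\<^sub>2 z)))"


section \<open>Contractions on Lebesgue spaces\<close>

text \<open>Elements of \<open>L\<^sup>p(\<real>, dx)\<close>, for an exponent \<open>1 \<le> p \<le> \<infinity>\<close>, are given by Borel representatives.\<close>

definition Lp_space :: "ennreal \<Rightarrow> (real \<Rightarrow> complex) set" where
  "Lp_space p = {f \<in> borel_measurable lborel.
     if p = \<infinity> then esssup lborel (\<lambda>x. ennreal (norm (f x))) < \<infinity>
     else integrable lborel (\<lambda>x. norm (f x) powr enn2real p)}"

definition Lp_norm :: "ennreal \<Rightarrow> (real \<Rightarrow> complex) \<Rightarrow> real" where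
  "Lp_norm p f =
     (if p = \<infinity> then enn2real (esssup lborel (\<lambda>x. ennreal (norm (f x))))
      else (LINT x|lborel. norm (f x) powr enn2real p) powr (1 / enn2real p))"

text \<open>The first condition makes \<open>T\<close> well defined on almost-everywhere classes.\<close>

definition Lp_contraction :: "ennreal \<Rightarrow> ((real \<Rightarrow> complex) \<Rightarrow> (real \<Rightarrow> complex)) \<Rightarrow> bool" where
  "Lp_contraction p T \<longleftrightarrow>
     (\<forall>f\<in>Lp_space p. \<forall>g\<in>Lp_space p. (AE x in lborel. f x = g x) \<longrightarrow> (AE x in lborel. T f x = T g x)) \<and>
     (\<forall>f\<in>Lp_space p. \<forall>g\<in>Lp_space p. \<forall>a b.
        AE x in lborel. T (\<lambda>y. a * f y + b * g y) x = a * T f x + b * T g x) \<and>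
     (\<forall>f\<in>Lp_space p. T f \<in> Lp_space p \<and> Lp_norm p (T f) \<le> Lp_norm p f)"

end

theory Submission
  imports Defs "HOL-Real_Asymp.Real_Asymp" "HOL-Computational_Algebra.Fundamental_Theorem_Algebra"
begin

text \<open>
  The operator \<open>K\<close> averages \<open>f\<close> against the Markov kernel \<open>x \<mapsto> \<delta>\<^sub>x \<rhd> \<nu>\<close>. Such an averaging operator is a
  contraction on every \<open>L\<^sup>p(dx)\<close>, by Jensen's inequality, as soon as the kernel preserves the Lebesgue
  measure: \<open>\<integral> (\<delta>\<^sub>x \<rhd> \<nu>)(B) dx = \<bar>B\<bar>\<close> (\<open>Lp_contraction_transition\<close>). The same fact gives integrability of \<open>f\<close>
  for almost every \<open>x\<close> and compatibility with null sets.

  Invariance is seen on Poisson integrals. Write \<open>w = F \<nu> z\<close> for \<open>z\<close> in the upper half plane; then \<open>w\<close> lies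
  there too. Up to the factor \<open>- pi\<close>, the integral of the Poisson kernel at \<open>z\<close> against \<open>\<delta>\<^sub>x \<rhd> \<nu>\<close> is the
  imaginary part of the Cauchy transform \<open>1 / (w - x)\<close>, and this is the Poisson kernel at \<open>w\<close> evaluated at \<open>x\<close>.
  Its integral over \<open>x\<close> is \<open>1\<close>, which is also the Poisson integral of the Lebesgue measure, and a measure
  is determined by its Poisson integrals (\<open>measure_eqI_poisson\<close>, a form of Stieltjes inversion for
  possibly infinite measures).

  It must also be known that \<open>\<delta>\<^sub>x \<rhd> \<nu>\<close> exists, that is, that \<open>G / (1 - x G)\<close> is the Cauchy transform of a
  probability measure if \<open>G\<close> is that of \<open>\<nu>\<close>. This is the spectral measure of a rank-one perturbation. For
  finitely supported \<open>\<nu>\<close> it is a partial fraction expansion with real simple poles and positive residues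
  (\<open>rank_one_perturbation_finite\<close>); the general case follows by approximation and tightness
  (\<open>rank_one_perturbation\<close>).
\<close>

section \<open>Poisson integrals determine a measure\<close>

text \<open>The Poisson kernel of the upper half plane at \<open>x + \<i> y\<close>, normalized to total mass \<open>1\<close> in \<open>t\<close>;
  up to the factor \<open>- pi\<close> it is the imaginary part of \<open>1 / (x + \<i> y - t)\<close>.\<close>

definition poisson_kernel :: "real \<Rightarrow> real \<Rightarrow> real \<Rightarrow> real" where
  "poisson_kernel y x t = y / (pi * ((t - x)\<^sup>2 + y\<^sup>2))"

lemma poisson_kernel_commute: "poisson_kernel y x t = poisson_kernel y t x"
  by (simp add: poisson_kernel_def power2_commute)

lemma poisson_kernel_nonneg: "0 \<le> y \<Longrightarrow> 0 \<le> poisson_kernel y x t"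
  by (simp add: poisson_kernel_def)

lemma poisson_kernel_pos: "0 < y \<Longrightarrow> 0 < poisson_kernel y x t"
  unfolding poisson_kernel_def
  by (intro divide_pos_pos mult_pos_pos add_nonneg_pos) auto

lemma borel_measurable_poisson_kernel [measurable (raw)]:
  assumes "f \<in> borel_measurable M" "g \<in> borel_measurable M"
  shows "(\<lambda>w. poisson_kernel y (f w) (g w)) \<in> borel_measurable M"
  using assms unfolding poisson_kernel_def by measurable

text \<open>The integral of the kernel over \<open>x\<close> from \<open>a\<close> to \<open>b\<close>, in closed form. For small \<open>y\<close> it is a
  smoothed indicator of the interval, and this is how Stieltjes inversion recovers a measure.\<close>

definition poisson_interval :: "real \<Rightarrow> real \<Rightarrow> real \<Rightarrow> real \<Rightarrow> real" where
  "poisson_interval y a b t = (arctan ((b - t) / y) - arctan ((a - t) / y)) / pi"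

lemma borel_measurable_poisson_interval [measurable]:
  "poisson_interval y a b \<in> borel_measurable borel"
  unfolding poisson_interval_def by measurable

lemma DERIV_poisson_kernel:
  assumes "0 < y"
  shows "((\<lambda>x. arctan ((x - t) / y) / pi) has_real_derivative poisson_kernel y x t) (at x)"
proof -
  have "(t - x)\<^sup>2 + y\<^sup>2 > 0" using assms by (intro add_nonneg_pos) auto
  then show ?thesis
    unfolding poisson_kernel_def using assms
    by (auto intro!: derivative_eq_intros simp: divide_simps) (simp add: power2_eq_square algebra_simps)
qed

lemma nn_integral_poisson_kernel_interval:
  assumes "0 < y" "a \<le> b"
  shows "(\<integral>\<^sup>+x. ennreal (poisson_kernel y x t) * indicator {a..b} x \<partial>lborel)
    = ennreal (poisson_interval y a b t)"
proof -
  have "(\<integral>\<^sup>+x. ennreal (poisson_kernel y x t) * indicator {a..b} x \<partial>lborel)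
    = arctan ((b - t) / y) / pi - arctan ((a - t) / y) / pi"
    by (rule nn_integral_FTC_Icc)
      (use assms in \<open>auto intro!: DERIV_poisson_kernel poisson_kernel_nonneg intro: DERIV_subset\<close>)
  then show ?thesis by (simp add: poisson_interval_def diff_divide_distrib)
qed

lemma UN_Icc_nat: "(\<Union>n. {- real n..real n}) = UNIV"
proof -
  have "\<exists>n. x \<in> {- real n..real n}" for x
    using real_arch_simple[of "\<bar>x\<bar>"] by (auto simp: abs_le_iff minus_le_iff)
  then show ?thesis by blast
qed

text \<open>The primitive \<open>arctan ((x - t) / y) / pi\<close> increases from \<open>- 1/2\<close> to \<open>1/2\<close>.\<close>

lemma nn_integral_poisson_kernel:
  assumes y: "0 < y"
  shows "(\<integral>\<^sup>+x. ennreal (poisson_kernel y x t) \<partial>lborel) = 1"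
proof -
  let ?D = "density lborel (\<lambda>x. ennreal (poisson_kernel y x t))"
  have "(\<lambda>n. emeasure ?D {- real n..real n}) \<longlonglongrightarrow> emeasure ?D (\<Union>n. {- real n..real n})"
    by (rule Lim_emeasure_incseq) (auto simp: incseq_def)
  note this[unfolded UN_Icc_nat]
  moreover have "emeasure ?D {- real n..real n} = ennreal (poisson_interval y (- real n) (real n) t)" for n
    using nn_integral_poisson_kernel_interval[OF y, of "- real n" "real n" t]
    by (simp add: emeasure_density)
  moreover have "emeasure ?D UNIV = (\<integral>\<^sup>+x. ennreal (poisson_kernel y x t) \<partial>lborel)"
    by (simp add: emeasure_density)
  moreover have "(\<lambda>n. ennreal (poisson_interval y (- real n) (real n) t)) \<longlonglongrightarrow> ennreal 1"
  proof (rule tendsto_ennrealI)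
    have "filterlim (\<lambda>n. (real n - t) / y) at_top sequentially"
      "filterlim (\<lambda>n. (- real n - t) / y) at_bot sequentially"
      using y by real_asymp+
    then have "(\<lambda>n. poisson_interval y (- real n) (real n) t) \<longlonglongrightarrow> (pi/2 - (- (pi/2))) / pi"
      unfolding poisson_interval_def
      by (intro tendsto_divide tendsto_diff tendsto_const
          filterlim_compose[OF tendsto_arctan_at_top] filterlim_compose[OF tendsto_arctan_at_bot]) auto
    then show "(\<lambda>n. poisson_interval y (- real n) (real n) t) \<longlonglongrightarrow> 1" by simp
  qed
  ultimately show ?thesis
    by (metis (no_types, lifting) LIMSEQ_unique ennreal_1 tendsto_cong ext)
qed

text \<open>A majorant uniform in \<open>y\<close> that is integrable for every measure with finite Poisson integral at \<open>\<i>\<close>.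
  Near the interval the trivial bound \<open>1\<close> suffices; away from it the mean value theorem turns the
  integral into one value of the kernel at some \<open>s\<close> in the interval, which decays like \<open>1 / (t - s)\<^sup>2\<close>.\<close>

lemma poisson_interval_le:
  assumes ab: "a < b"
  obtains C where "0 \<le> C" "\<And>y t. 0 < y \<Longrightarrow> y \<le> 1 \<Longrightarrow> poisson_interval y a b t \<le> C * poisson_kernel 1 0 t"
proof
  define m where "m = max \<bar>a\<bar> \<bar>b\<bar>"
  define c where "c = 1 + (m + 1)\<^sup>2"
  have m: "0 \<le> m" "\<bar>a\<bar> \<le> m" "\<bar>b\<bar> \<le> m" by (auto simp: m_def)
  have c: "1 \<le> c" by (simp add: c_def)
  show "0 \<le> c * (pi + (b - a))" using c ab by simp
  fix y t :: real assume y: "0 < y" "y \<le> 1"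
  have t1: "0 < 1 + t\<^sup>2" by (intro add_pos_nonneg) auto
  have P: "poisson_kernel 1 0 t = 1 / (pi * (1 + t\<^sup>2))"
    by (simp add: poisson_kernel_def add.commute)
  show "poisson_interval y a b t \<le> c * (pi + (b - a)) * poisson_kernel 1 0 t"
  proof (cases "\<bar>t\<bar> \<le> m + 1")
    case True
    then have "t\<^sup>2 \<le> (m + 1)\<^sup>2" by (metis abs_le_square_iff abs_of_nonneg add_nonneg_nonneg m(1) zero_le_one)
    then have "1 + t\<^sup>2 \<le> c" by (simp add: c_def)
    have "arctan ((b - t) / y) - arctan ((a - t) / y) \<le> pi"
      using arctan_bounded[of "(b - t) / y"] arctan_bounded[of "(a - t) / y"] by linarith
    then have "poisson_interval y a b t \<le> 1" by (simp add: poisson_interval_def)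
    also have "1 \<le> (c * pi) * poisson_kernel 1 0 t" using \<open>1 + t\<^sup>2 \<le> c\<close> t1 by (simp add: P)
    also have "\<dots> \<le> c * (pi + (b - a)) * poisson_kernel 1 0 t"
      using ab c by (intro mult_right_mono mult_left_mono poisson_kernel_nonneg) auto
    finally show ?thesis .
  next
    case False
    obtain s where s: "a < s" "s < b" 
      "arctan ((b - t) / y) / pi - arctan ((a - t) / y) / pi = (b - a) * poisson_kernel y s t"
      using MVT2[OF ab, of "\<lambda>x. arctan ((x - t) / y) / pi" "\<lambda>x. poisson_kernel y x t"]
        DERIV_poisson_kernel[OF y(1)] by blast
    have dist: "\<bar>t\<bar> - m \<le> \<bar>t - s\<bar>" using s m by linarith
    \<comment> \<open>The point is at distance at least \<open>1\<close> from \<open>s\<close>, so \<open>\<bar>t\<bar> \<le> (m + 1) \<bar>t - s\<bar>\<close>.\<close>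
    have "\<bar>t\<bar> + m * (\<bar>t\<bar> - m - 1) = (m + 1) * (\<bar>t\<bar> - m)" by (simp add: algebra_simps)
    also have "\<dots> \<le> (m + 1) * \<bar>t - s\<bar>" using m dist by (intro mult_left_mono) auto
    finally have "\<bar>t\<bar> + m * (\<bar>t\<bar> - m - 1) \<le> (m + 1) * \<bar>t - s\<bar>" .
    moreover have "0 \<le> m * (\<bar>t\<bar> - m - 1)" using m False by simp
    ultimately have "\<bar>t\<bar> \<le> \<bar>(m + 1) * (t - s)\<bar>" using m(1) by (simp add: abs_mult)
    then have "t\<^sup>2 \<le> (m + 1)\<^sup>2 * (t - s)\<^sup>2" by (metis abs_le_square_iff power_mult_distrib)
    moreover have "1 \<le> (t - s)\<^sup>2" using dist False abs_le_square_iff[of 1 "t - s"] by simp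
    ultimately have "1 + t\<^sup>2 \<le> c * (t - s)\<^sup>2" by (simp add: c_def algebra_simps)
    have "poisson_kernel y s t \<le> 1 / (pi * (t - s)\<^sup>2)"
      unfolding poisson_kernel_def
      by (rule frac_le) (use y \<open>1 \<le> (t - s)\<^sup>2\<close> in \<open>auto intro!: mult_pos_pos\<close>)
    also have "\<dots> \<le> c * poisson_kernel 1 0 t"
    proof -
      have "0 < (t - s)\<^sup>2" using \<open>1 \<le> (t - s)\<^sup>2\<close> by linarith
      then have "1 / (t - s)\<^sup>2 \<le> c / (1 + t\<^sup>2)"
        using \<open>1 + t\<^sup>2 \<le> c * (t - s)\<^sup>2\<close> t1 by (simp only: divide_le_eq le_divide_eq times_divide_eq_left mult_1 if_True)
      from divide_right_mono[OF this, of pi] show ?thesis by (simp add: P mult.commute)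
    qed
    finally have "(b - a) * poisson_kernel y s t \<le> (b - a) * (c * poisson_kernel 1 0 t)"
      using ab by (intro mult_left_mono) auto
    also have "\<dots> = c * (b - a) * poisson_kernel 1 0 t" by simp
    also have "\<dots> \<le> c * (pi + (b - a)) * poisson_kernel 1 0 t"
      using ab c by (intro mult_right_mono mult_left_mono poisson_kernel_nonneg) auto
    finally show ?thesis using s(3) by (simp add: poisson_interval_def diff_divide_distrib)
  qed
qed

text \<open>At a boundary point half of the mass of the kernel falls on each side, so the limit of the smoothed
  indicators takes the value \<open>1/2\<close> there.\<close>

definition half_boundary_indicator :: "real \<Rightarrow> real \<Rightarrow> real \<Rightarrow> real" where
  "half_boundary_indicator a b t = (indicator {a..b} t + indicator {a<..<b} t) / 2"

lemma borel_measurable_half_boundary_indicator [measurable]: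
  "half_boundary_indicator a b \<in> borel_measurable borel"
  unfolding half_boundary_indicator_def by measurable

lemma poisson_interval_tendsto:
  assumes "a < b"
  shows "(\<lambda>n. poisson_interval (1 / Suc n) a b t) \<longlonglongrightarrow> half_boundary_indicator a b t"
proof -
  have lim: "(\<lambda>n. arctan ((c - t) / (1 / real (Suc n)))) \<longlonglongrightarrow> (pi/2) * sgn (c - t)" for c
  proof -
    consider "c < t" | "c = t" | "c > t" by linarith
    then show ?thesis
    proof cases
      case 1
      then have "filterlim (\<lambda>n. (c - t) / (1 / real (Suc n))) at_bot sequentially"
        by real_asymp
      from filterlim_compose[OF tendsto_arctan_at_bot this] 1 show ?thesis by simp
    next
      case 3
      then have "filterlim (\<lambda>n. (c - t) / (1 / real (Suc n))) at_top sequentially"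
        by real_asymp
      from filterlim_compose[OF tendsto_arctan_at_top this] 3 show ?thesis by simp
    qed simp
  qed
  have "(\<lambda>n. poisson_interval (1 / Suc n) a b t) \<longlonglongrightarrow> (pi/2 * sgn (b - t) - pi/2 * sgn (a - t)) / pi"
    unfolding poisson_interval_def by (intro tendsto_intros lim) auto
  also have "(pi/2 * sgn (b - t) - pi/2 * sgn (a - t)) / pi = half_boundary_indicator a b t"
    using assms by (auto simp: half_boundary_indicator_def sgn_if indicator_def field_simps)
  finally show ?thesis .
qed

text \<open>Such measures are locally finite, hence \<open>\<sigma>\<close>-finite, as Tonelli's theorem requires.\<close>

lemma emeasure_Icc_finite_if_poisson_finite:
  assumes sets: "sets M = sets borel"
    and fin: "(\<integral>\<^sup>+t. ennreal (poisson_kernel 1 0 t) \<partial>M) < \<infinity>"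
  shows "emeasure M {a..b} < \<infinity>"
proof -
  note [measurable_cong] = sets
  define m where "m = max \<bar>a\<bar> \<bar>b\<bar>"
  have "emeasure M {a..b} = (\<integral>\<^sup>+t. indicator {a..b} t \<partial>M)" by (simp add: sets)
  also have "\<dots> \<le> (\<integral>\<^sup>+t. ennreal (pi * (1 + m\<^sup>2)) * ennreal (poisson_kernel 1 0 t) \<partial>M)"
  proof (rule nn_integral_mono)
    fix t
    have "1 \<le> pi * (1 + m\<^sup>2) * poisson_kernel 1 0 t" if "t \<in> {a..b}"
    proof -
      have "\<bar>t\<bar> \<le> \<bar>m\<bar>" using that by (auto simp: m_def)
      then have "t\<^sup>2 \<le> m\<^sup>2" by (simp add: abs_le_square_iff)
      moreover have "0 < 1 + t\<^sup>2" by (intro add_pos_nonneg) auto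
      ultimately show ?thesis by (simp add: poisson_kernel_def add.commute)
    qed
    then show "indicator {a..b} t \<le> ennreal (pi * (1 + m\<^sup>2)) * ennreal (poisson_kernel 1 0 t)"
      by (auto simp: indicator_def ennreal_mult'[symmetric] poisson_kernel_nonneg)
  qed
  also have "\<dots> = ennreal (pi * (1 + m\<^sup>2)) * (\<integral>\<^sup>+t. ennreal (poisson_kernel 1 0 t) \<partial>M)"
    by (rule nn_integral_cmult) measurable
  also have "\<dots> < \<infinity>" using fin by (simp add: ennreal_mult_less_top)
  finally show ?thesis .
qed

text \<open>Stieltjes inversion: by Tonelli the integral over \<open>x\<close> of the Poisson integrals is the integral of the
  smoothed indicators, which converges by dominated convergence.\<close>

lemma nn_integral_half_boundary_indicator_poisson:
  assumes sets: "sets M = sets borel"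
    and fin: "(\<integral>\<^sup>+t. ennreal (poisson_kernel 1 0 t) \<partial>M) < \<infinity>"
    and ab: "a < b"
  shows "(\<lambda>n. \<integral>\<^sup>+x. (\<integral>\<^sup>+t. ennreal (poisson_kernel (1 / Suc n) x t) \<partial>M) * indicator {a..b} x \<partial>lborel)
    \<longlonglongrightarrow> (\<integral>\<^sup>+t. ennreal (half_boundary_indicator a b t) \<partial>M)"
proof -
  note [measurable_cong] = sets
  interpret M: sigma_finite_measure M
  proof
    show "\<exists>A. countable A \<and> A \<subseteq> sets M \<and> \<Union>A = space M \<and> (\<forall>a\<in>A. emeasure M a \<noteq> \<infinity>)"
      using UN_Icc_nat emeasure_Icc_finite_if_poisson_finite[OF sets fin] sets_eq_imp_space_eq[OF sets]
      by (intro exI[of _ "range (\<lambda>n. {- real n..real n})"]) (auto simp: sets less_top)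
  qed
  interpret pair_sigma_finite M lborel ..
  have fub: "(\<integral>\<^sup>+x. (\<integral>\<^sup>+t. ennreal (poisson_kernel y x t) \<partial>M) * indicator {a..b} x \<partial>lborel)
      = (\<integral>\<^sup>+t. ennreal (poisson_interval y a b t) \<partial>M)" if y: "0 < y" for y
  proof -
    have "(\<integral>\<^sup>+x. (\<integral>\<^sup>+t. ennreal (poisson_kernel y x t) \<partial>M) * indicator {a..b} x \<partial>lborel)
      = (\<integral>\<^sup>+x. (\<integral>\<^sup>+t. ennreal (poisson_kernel y x t) * indicator {a..b} x \<partial>M) \<partial>lborel)"
      by (intro nn_integral_cong nn_integral_multc[symmetric]) measurable
    also have "\<dots> = (\<integral>\<^sup>+t. (\<integral>\<^sup>+x. ennreal (poisson_kernel y x t) * indicator {a..b} x \<partial>lborel) \<partial>M)"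
      by (rule Fubini') measurable
    finally show ?thesis using nn_integral_poisson_kernel_interval[OF y less_imp_le[OF ab]] by simp
  qed
  obtain C where C: "0 \<le> C"
    "\<And>y t. 0 < y \<Longrightarrow> y \<le> 1 \<Longrightarrow> poisson_interval y a b t \<le> C * poisson_kernel 1 0 t"
    using poisson_interval_le[OF ab] by blast
  have "(\<lambda>n. \<integral>\<^sup>+t. ennreal (poisson_interval (1 / Suc n) a b t) \<partial>M)
    \<longlonglongrightarrow> (\<integral>\<^sup>+t. ennreal (half_boundary_indicator a b t) \<partial>M)"
  proof (rule nn_integral_dominated_convergence[where w="\<lambda>t. ennreal C * ennreal (poisson_kernel 1 0 t)"])
    show "(\<integral>\<^sup>+t. ennreal C * ennreal (poisson_kernel 1 0 t) \<partial>M) < \<infinity>"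
      using fin by (subst nn_integral_cmult) (auto simp: ennreal_mult_less_top)
    show "AE t in M. ennreal (poisson_interval (1 / Suc n) a b t) \<le> ennreal C * ennreal (poisson_kernel 1 0 t)" for n
      using C(2)[of "1 / Suc n"] C(1)
      by (auto intro!: ennreal_leI simp: ennreal_mult'[symmetric] poisson_kernel_nonneg)
    show "AE t in M. (\<lambda>n. ennreal (poisson_interval (1 / Suc n) a b t)) \<longlonglongrightarrow> ennreal (half_boundary_indicator a b t)"
      using poisson_interval_tendsto[OF ab] by (auto intro!: tendsto_ennrealI)
  qed measurable
  then show ?thesis using fub[of "1 / Suc n" for n] by simp
qed

text \<open>Exhausting an open interval by slightly smaller ones removes the boundary terms, so that atoms need
  no separate treatment.\<close>

lemma nn_integral_half_boundary_indicator_tendsto: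
  assumes sets: "sets M = sets borel" and fin: "emeasure M {a..b} < \<infinity>" and ab: "a < b"
  shows "(\<lambda>n. \<integral>\<^sup>+t. ennreal (half_boundary_indicator (a + (b - a) / (n + 3)) (b - (b - a) / (n + 3)) t) \<partial>M)
    \<longlonglongrightarrow> emeasure M {a<..<b}"
proof -
  note [measurable_cong] = sets
  \<comment> \<open>The summand \<open>3\<close> keeps the endpoints of the smaller interval in order for every \<open>n\<close>.\<close>
  define d where "d n = (b - a) / (real n + 3)" for n
  have d: "0 < d n" for n using ab by (simp add: d_def)
  have d0: "d \<longlonglongrightarrow> 0" unfolding d_def by real_asymp
  have "(\<lambda>n. \<integral>\<^sup>+t. ennreal (half_boundary_indicator (a + d n) (b - d n) t) \<partial>M)
    \<longlonglongrightarrow> (\<integral>\<^sup>+t. indicator {a<..<b} t \<partial>M)"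
  proof (rule nn_integral_dominated_convergence[where w="indicator {a..b}"])
    show "(\<integral>\<^sup>+t. indicator {a..b} t \<partial>M) < \<infinity>" using fin by (simp add: sets)
    show "AE t in M. ennreal (half_boundary_indicator (a + d n) (b - d n) t) \<le> indicator {a..b} t" for n
      using d[of n] by (intro AE_I2) (auto simp: half_boundary_indicator_def indicator_def)
    have "(\<lambda>n. ennreal (half_boundary_indicator (a + d n) (b - d n) t)) \<longlonglongrightarrow> indicator {a<..<b} t" for t
    proof (rule tendsto_eventually)
      show "\<forall>\<^sub>F n in sequentially. ennreal (half_boundary_indicator (a + d n) (b - d n) t) = indicator {a<..<b} t"
      proof (cases "a < t \<and> t < b")
        case True
        then have "\<forall>\<^sub>F n in sequentially. d n < min (t - a) (b - t)"
          by (intro order_tendstoD(2)[OF d0]) auto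
        then show ?thesis
          by eventually_elim (use True in \<open>auto simp: half_boundary_indicator_def indicator_def\<close>)
      next
        case False
        then have "half_boundary_indicator (a + d n) (b - d n) t = 0" for n
          using d[of n] by (auto simp: half_boundary_indicator_def indicator_def)
        then show ?thesis using False by (auto simp: indicator_def)
      qed
    qed
    then show "AE t in M. (\<lambda>n. ennreal (half_boundary_indicator (a + d n) (b - d n) t)) \<longlonglongrightarrow> indicator {a<..<b} t"
      by simp
  qed measurable
  then show ?thesis by (simp add: d_def sets)
qed

text \<open>The measures may be infinite: besides probability measures this covers the Lebesgue measure, all of
  whose Poisson integrals are \<open>1\<close>.\<close>

theorem measure_eqI_poisson:
  assumes M: "sets M = sets borel" and N: "sets N = sets borel"
    and eq: "\<And>x y. 0 < y \<Longrightarrow> (\<integral>\<^sup>+t. ennreal (poisson_kernel y x t) \<partial>M) = (\<integral>\<^sup>+t. ennreal (poisson_kernel y x t) \<partial>N)"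
    and fin: "(\<integral>\<^sup>+t. ennreal (poisson_kernel 1 0 t) \<partial>M) < \<infinity>"
  shows "M = N"
proof (rule measure_eqI_generator_eq)
  have fin': "(\<integral>\<^sup>+t. ennreal (poisson_kernel 1 0 t) \<partial>N) < \<infinity>" using fin eq[of 1 0] by simp
  let ?E = "range (\<lambda>(a, b). box a b::real set)"
  show "Int_stable ?E"
    by (auto simp: Int_stable_def box_Int_box simp del: box_real)
  show "?E \<subseteq> Pow UNIV" "sets M = sigma_sets UNIV ?E" "sets N = sigma_sets UNIV ?E"
    by (simp_all add: borel_eq_box M N)
  let ?A = "\<lambda>n::nat. box (- (real n *\<^sub>R One)) (real n *\<^sub>R One) :: real set"
  show "range ?A \<subseteq> ?E" "(\<Union>i. ?A i) = UNIV"
    unfolding UN_box_eq_UNIV by auto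
  have "emeasure M {a<..<b} \<le> emeasure M {a..b}" for a b
    by (rule emeasure_mono) (auto simp: M)
  then show "emeasure M (?A i) \<noteq> \<infinity>" for i
    using emeasure_Icc_finite_if_poisson_finite[OF M fin, of "- real i" "real i"]
    by (simp add: less_top) (meson le_less_trans)
  fix X assume "X \<in> ?E"
  then obtain a b where X: "X = {a<..<b}" by auto
  have half: "(\<integral>\<^sup>+t. ennreal (half_boundary_indicator c d t) \<partial>M) = (\<integral>\<^sup>+t. ennreal (half_boundary_indicator c d t) \<partial>N)"
    if "c < d" for c d
    using nn_integral_half_boundary_indicator_poisson[OF M fin that]
      nn_integral_half_boundary_indicator_poisson[OF N fin' that] 
    by (intro LIMSEQ_unique) (simp_all add: eq)
  show "emeasure M X = emeasure N X"
  proof (cases "a < b")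
    case True
    have "a + (b - a) / (real n + 3) < b - (b - a) / (real n + 3)" for n
    proof -
      have "(b - a) * (2 / (real n + 3)) < (b - a) * 1"
        using True by (intro mult_strict_left_mono) auto
      also have "(b - a) * (2 / (real n + 3)) = (b - a) / (real n + 3) + (b - a) / (real n + 3)"
        by (simp add: add_divide_distrib[symmetric])
      finally show ?thesis by simp
    qed
    from half[OF this]
    show ?thesis
      using LIMSEQ_unique[OF
        nn_integral_half_boundary_indicator_tendsto[OF M emeasure_Icc_finite_if_poisson_finite[OF M fin] True]]
        nn_integral_half_boundary_indicator_tendsto[OF N emeasure_Icc_finite_if_poisson_finite[OF N fin'] True]
      by (simp add: X)
  qed (simp add: X)
qed

section \<open>Rank-one perturbation of finitely many point masses\<close>

definition linear_factors :: "'a::field set \<Rightarrow> 'a poly" where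
  "linear_factors A = (\<Prod>u\<in>A. [:- u, 1:])"

lemma poly_linear_factors: "poly (linear_factors A) z = (\<Prod>u\<in>A. z - u)"
  by (simp add: linear_factors_def poly_prod)

lemma degree_linear_factors: "degree (linear_factors A) = card A"
  by (simp add: linear_factors_def degree_prod_eq_sum_degree)

lemma coeff_linear_factors: "coeff (linear_factors A) (card A) = 1"
  using lead_coeff_prod[of "\<lambda>u. [:- u, 1:]" A]
  by (simp add: degree_linear_factors[symmetric]) (simp add: linear_factors_def)

lemma linear_factors_remove:
  "finite A \<Longrightarrow> a \<in> A \<Longrightarrow> poly (linear_factors A) z = (z - a) * poly (linear_factors (A - {a})) z"
  by (simp add: poly_linear_factors prod.remove)

text \<open>The polynomial \<open>P\<close> for which \<open>P / linear_factors A\<close> has the partial fraction expansion with simple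
  poles \<open>a \<in> A\<close> and residues \<open>c a\<close>.\<close>

definition partial_fraction_numerator :: "'a::field set \<Rightarrow> ('a \<Rightarrow> 'a) \<Rightarrow> 'a poly" where
  "partial_fraction_numerator A c = (\<Sum>a\<in>A. smult (c a) (linear_factors (A - {a})))"

lemma poly_partial_fraction_numerator:
  assumes "finite A" "z \<notin> A"
  shows "poly (partial_fraction_numerator A c) z = poly (linear_factors A) z * (\<Sum>a\<in>A. c a / (z - a))"
  unfolding partial_fraction_numerator_def poly_sum sum_distrib_left
proof (rule sum.cong)
  fix a assume "a \<in> A"
  then show "poly (smult (c a) (linear_factors (A - {a}))) z = poly (linear_factors A) z * (c a / (z - a))"
    using assms by (auto simp: linear_factors_remove[OF assms(1)])
qed simp

lemma poly_partial_fraction_numerator_pole: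
  assumes "finite A" "b \<in> A"
  shows "poly (partial_fraction_numerator A c) b = c b * poly (linear_factors (A - {b})) b"
proof -
  have "poly (partial_fraction_numerator A c) b = (\<Sum>a\<in>A. c a * poly (linear_factors (A - {a})) b)"
    by (simp add: partial_fraction_numerator_def poly_sum)
  also have "\<dots> = c b * poly (linear_factors (A - {b})) b + (\<Sum>a\<in>A - {b}. c a * poly (linear_factors (A - {a})) b)"
    using assms by (rule sum.remove)
  also have "(\<Sum>a\<in>A - {b}. c a * poly (linear_factors (A - {a})) b) = 0"
    using assms by (intro sum.neutral) (auto simp: poly_linear_factors)
  finally show ?thesis by simp
qed

lemma degree_partial_fraction_numerator:
  assumes "finite A" "A \<noteq> {}"
  shows "degree (partial_fraction_numerator A c) < card A"
proof -
  have "degree (partial_fraction_numerator A c) \<le> card A - 1"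
    unfolding partial_fraction_numerator_def
    using assms by (intro degree_sum_le order_trans[OF degree_smult_le]) (auto simp: degree_linear_factors)
  then show ?thesis using assms by (metis Suc_pred' card_gt_0_iff le_imp_less_Suc)
qed

text \<open>The top coefficient is the sum of the residues; it carries the total mass from one expansion to
  another with the same numerator.\<close>

lemma coeff_partial_fraction_numerator:
  assumes "finite A"
  shows "coeff (partial_fraction_numerator A c) (card A - 1) = sum c A"
proof -
  have "coeff (linear_factors (A - {a})) (card A - 1) = 1" if "a \<in> A" for a
    using coeff_linear_factors[of "A - {a}"] that assms by simp
  then show ?thesis by (simp add: partial_fraction_numerator_def coeff_sum)
qed

lemma poly_pderiv_linear_factors:
  assumes "finite A" "b \<in> A"
  shows "poly (pderiv (linear_factors A)) b = poly (linear_factors (A - {b})) b"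
proof -
  have "linear_factors A = [:- b, 1:] * linear_factors (A - {b})"
    using assms unfolding linear_factors_def by (rule prod.remove)
  then show ?thesis by (simp only: pderiv_mult) (simp add: pderiv_pCons)
qed

text \<open>All summands have an imaginary part of the sign opposite to that of \<open>Im z\<close>.\<close>

lemma Im_cauchy_sum_nonzero:
  fixes w :: "real \<Rightarrow> real"
  assumes S: "finite S" "S \<noteq> {}" and w: "\<And>t. t \<in> S \<Longrightarrow> 0 < w t" and z: "z \<notin> \<real>"
  shows "Im (\<Sum>t\<in>S. of_real (w t) / (z - of_real t)) \<noteq> 0"
proof -
  have Im: "Im z \<noteq> 0" using z by (simp add: complex_is_Real_iff)
  have "Im (of_real (w t) / (z - of_real t)) = - Im z * (w t / (cmod (z - of_real t))\<^sup>2)" for t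
    by (simp add: Im_divide cmod_power2)
  then have "Im (\<Sum>t\<in>S. of_real (w t) / (z - of_real t)) = - Im z * (\<Sum>t\<in>S. w t / (cmod (z - of_real t))\<^sup>2)"
    by (simp add: sum_distrib_left)
  moreover have "0 < (\<Sum>t\<in>S. w t / (cmod (z - of_real t))\<^sup>2)"
    using S z w by (intro sum_pos divide_pos_pos) auto
  ultimately show ?thesis using Im by simp
qed

text \<open>Let \<open>x \<noteq> 0\<close>. If \<open>G = P / Q\<close>, then \<open>G / (1 - x G) = P / R\<close> with \<open>R = Q - x P\<close>. Its
  poles are the solutions of \<open>G = 1 / x\<close>.
  They are real because \<open>G\<close> takes real values only on the real line, and simple because \<open>G' < 0\<close> there, and
  the residue at such a point is \<open>- 1 / (x\<^sup>2 G')\<close>, which is positive. Since \<open>R\<close> has the degree of \<open>Q\<close> and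
  the numerators agree, the residues again add up to \<open>1\<close>. In terms of operators, \<open>G\<close> is the spectral
  transform of a diagonal matrix at a cyclic unit vector, and the result is that of its perturbation by
  \<open>x\<close> times the projection onto this vector.\<close>

theorem rank_one_perturbation_finite:
  fixes S :: "real set" and w :: "real \<Rightarrow> real" and x :: real
  assumes S: "finite S" and w: "\<And>t. t \<in> S \<Longrightarrow> 0 < w t" and w1: "sum w S = 1"
  defines "G (z :: complex) \<equiv> \<Sum>t\<in>S. of_real (w t) / (z - of_real t)"
  obtains Z c where "finite Z" "\<And>r. r \<in> Z \<Longrightarrow> 0 < c r" "sum c Z = (1::real)"
    "\<And>z. z \<notin> \<real> \<Longrightarrow> (\<Sum>r\<in>Z. of_real (c r) / (z - of_real r)) = G z / (1 - of_real x * G z)"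
proof (cases "x = 0")
  case True
  show thesis by (rule that[of S w]) (use True S w w1 in \<open>auto simp: G_def\<close>)
next
  case x: False
  have ne: "S \<noteq> {}" using w1 by auto
  define A where "A = complex_of_real ` S"
  have A: "finite A" "A \<noteq> {}" using S ne by (auto simp: A_def)
  define v where "v a = complex_of_real (w (Re a))" for a
  have G: "G z = (\<Sum>a\<in>A. v a / (z - a))" for z
    unfolding G_def A_def v_def by (subst sum.reindex) (auto simp: inj_on_def)
  define P where "P = partial_fraction_numerator A v"
  define Q where "Q = linear_factors A"
  define R where "R = Q - smult (of_real x) P"
  have P: "poly P z = poly Q z * G z" if "z \<notin> A" for z
    using poly_partial_fraction_numerator[OF A(1) that] by (simp add: P_def Q_def G)
  have R: "poly R z = poly Q z * (1 - of_real x * G z)" if "z \<notin> A" for z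
    using P[OF that] by (simp add: R_def algebra_simps)
  have Q0: "poly Q z \<noteq> 0" if "z \<notin> A" for z
    using that A(1) by (auto simp: Q_def poly_linear_factors)
  have root: "z \<in> \<real>" "z \<notin> A" "of_real x * G z = 1" "poly Q z \<noteq> 0" if z: "poly R z = 0" for z
  proof -
    show "z \<notin> A"
    proof
      assume zA: "z \<in> A"
      then have "poly Q z = 0" using A(1) by (auto simp: Q_def poly_linear_factors)
      moreover have "poly P z \<noteq> 0"
        using w zA A(1) unfolding P_def poly_partial_fraction_numerator_pole[OF A(1) zA]
        by (fastforce simp: poly_linear_factors A_def v_def)
      ultimately show False using z x by (simp add: R_def)
    qed
    then show "of_real x * G z = 1" and "poly Q z \<noteq> 0" using z R Q0 by auto
    then have "x * Im (G z) = 0" by (auto dest: arg_cong[of _ _ Im])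
    then have "Im (G z) = 0" using x by simp
    then show "z \<in> \<real>"
      using Im_cauchy_sum_nonzero[OF S ne, of w z] w unfolding G_def by blast
  qed
  have degP: "degree P < card A"
    unfolding P_def by (rule degree_partial_fraction_numerator[OF A])
  have "degree (smult (of_real x) P) < degree Q"
    using degP by (simp add: Q_def degree_linear_factors)
  then have deg: "degree (- smult (of_real x) P) < degree Q" by simp
  have R_eq: "R = Q + (- smult (of_real x) P)" by (simp add: R_def)
  have degR: "degree R = card A"
    unfolding R_eq degree_add_eq_left[OF deg] by (simp add: Q_def degree_linear_factors)
  moreover have "coeff R (card A) = 1"
    using degP coeff_linear_factors[of A] by (simp add: R_def Q_def coeff_eq_0)
  ultimately have lead: "lead_coeff R = 1" by simp
  \<comment> \<open>This is the negative derivative of \<open>G\<close> on the real line.\<close>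
  define D where "D r = (\<Sum>t\<in>S. w t / (r - t)\<^sup>2)" for r :: real
  have derivR: "poly (pderiv R) (of_real r) = of_real x * poly Q (of_real r) * of_real (D r)" and D: "0 < D r"
    if r: "poly R (of_real r) = 0" for r
  proof -
    have rA: "of_real r \<notin> A" and xG: "of_real x * G (of_real r) = 1" using root[OF r] by auto
    have "(G has_field_derivative (\<Sum>a\<in>A. - v a / (of_real r - a)\<^sup>2)) (at (of_real r))"
      unfolding G[abs_def] using rA
      by (auto intro!: derivative_eq_intros sum.cong simp: power2_eq_square)
    also have "(\<Sum>a\<in>A. - v a / (of_real r - a)\<^sup>2) = - of_real (D r)"
      unfolding A_def v_def D_def by (subst sum.reindex) (auto simp: inj_on_def sum_negf)
    finally have dG: "(G has_field_derivative - of_real (D r)) (at (of_real r))" .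
    have "((\<lambda>z. poly Q z * (1 - of_real x * G z)) has_field_derivative
        of_real x * poly Q (of_real r) * of_real (D r)) (at (of_real r))"
      using xG by (auto intro!: derivative_eq_intros dG simp: algebra_simps)
    then have "(poly R has_field_derivative of_real x * poly Q (of_real r) * of_real (D r)) (at (of_real r))"
      by (rule has_field_derivative_transform_within_open[where S="- A"])
        (use rA A(1) R in \<open>auto intro: finite_imp_closed\<close>)
    then show "poly (pderiv R) (of_real r) = of_real x * poly Q (of_real r) * of_real (D r)"
      using DERIV_unique poly_DERIV by blast
    show "0 < D r"
      unfolding D_def using S ne w rA by (intro sum_pos divide_pos_pos) (auto simp: A_def)
  qed
  define Z where "Z = {r. poly R (complex_of_real r) = 0}"
  define B where "B = {z. poly R z = 0}"
  have B: "B = of_real ` Z" using root(1) unfolding B_def Z_def by (fastforce elim: Reals_cases)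
  have R0: "R \<noteq> 0" using lead by auto
  have finB: "finite B" unfolding B_def using R0 by (rule poly_roots_finite)
  have finZ: "finite Z" using finB unfolding B by (rule finite_imageD) (simp add: inj_on_def)
  have "rsquarefree R"
    unfolding rsquarefree_roots
  proof safe
    fix a assume a: "poly R a = 0" "poly (pderiv R) a = 0"
    then obtain r where "a = of_real r" using root(1) by (auto elim: Reals_cases)
    then show False using a derivR[of r] D[of r] root(4)[of a] x by auto
  qed
  from complex_poly_decompose_rsquarefree[OF this] have RB: "R = linear_factors B"
    using lead by (simp add: B_def linear_factors_def)
  have cardB: "card B = card A" using degR unfolding RB degree_linear_factors by simp
  define c where "c r = 1 / (x\<^sup>2 * D r)" for r
  have res: "poly P b = of_real (c (Re b)) * poly (linear_factors (B - {b})) b" if b: "b \<in> B" for b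
  proof -
    obtain r where r: "b = of_real r" "r \<in> Z" using b B by auto
    then have r0: "poly R (of_real r) = 0" by (simp add: Z_def)
    have "poly (linear_factors (B - {b})) b = of_real x * poly Q b * of_real (D r)"
      using derivR[OF r0] poly_pderiv_linear_factors[OF finB b] by (simp add: RB r)
    moreover have "of_real x * poly P b = poly Q b"
      using P[of b] root(2,3)[of b] r0 r by (simp add: algebra_simps)
    ultimately show ?thesis
      using x D[OF r0] by (simp add: c_def r power2_eq_square field_simps)
  qed
  \<comment> \<open>Lagrange interpolation at the \<open>card A\<close> poles, the degrees being smaller.\<close>
  have Ppf: "P = partial_fraction_numerator B (\<lambda>b. of_real (c (Re b)))"
  proof (rule poly_eqI_degree[where A=B])
    show "poly P b = poly (partial_fraction_numerator B (\<lambda>b. of_real (c (Re b)))) b" if "b \<in> B" for b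
      using res[OF that] by (simp add: poly_partial_fraction_numerator_pole[OF finB that])
    show "degree P < card B" using degP cardB by simp
    have "B \<noteq> {}" using cardB A finB by auto
    then show "degree (partial_fraction_numerator B (\<lambda>b. of_real (c (Re b)))) < card B"
      by (rule degree_partial_fraction_numerator[OF finB])
  qed
  show thesis
  proof (rule that[of Z c])
    show "finite Z" by (rule finZ)
    show "0 < c r" if "r \<in> Z" for r using that D[of r] x by (simp add: c_def Z_def)
    have "(\<Sum>b\<in>B. of_real (c (Re b))) = coeff P (card B - 1)"
      unfolding Ppf coeff_partial_fraction_numerator[OF finB] by (rule refl)
    also have "\<dots> = (\<Sum>a\<in>A. v a)"
      unfolding P_def cardB coeff_partial_fraction_numerator[OF A(1)] by (rule refl)
    also have "\<dots> = of_real (sum w S)"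
      unfolding A_def v_def by (subst sum.reindex) (auto simp: inj_on_def)
    also have "(\<Sum>b\<in>B. of_real (c (Re b))) = complex_of_real (sum c Z)"
      unfolding B by (subst sum.reindex) (auto simp: inj_on_def)
    finally show "sum c Z = 1" using w1 by (simp only: of_real_eq_iff)
    fix z :: complex assume z: "z \<notin> \<real>"
    have zB: "z \<notin> B" and zA: "z \<notin> A" using z B by (auto simp: A_def)
    have "poly P z = poly R z * (\<Sum>b\<in>B. of_real (c (Re b)) / (z - b))"
      unfolding RB by (subst Ppf) (rule poly_partial_fraction_numerator[OF finB zB])
    also have "(\<Sum>b\<in>B. of_real (c (Re b)) / (z - b)) = (\<Sum>r\<in>Z. of_real (c r) / (z - of_real r))"
      unfolding B by (subst sum.reindex) (auto simp: inj_on_def)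
    finally have "poly Q z * G z = poly Q z * ((1 - of_real x * G z) * (\<Sum>r\<in>Z. of_real (c r) / (z - of_real r)))"
      using P[OF zA] R[OF zA] by (simp only: mult.assoc)
    then have "G z = (1 - of_real x * G z) * (\<Sum>r\<in>Z. of_real (c r) / (z - of_real r))"
      using Q0[OF zA] by (simp only: mult_left_cancel not_False_eq_True)
    moreover have "1 - of_real x * G z \<noteq> 0" using zB R[OF zA] by (auto simp: B_def)
    ultimately show "(\<Sum>r\<in>Z. of_real (c r) / (z - of_real r)) = G z / (1 - of_real x * G z)"
      by (metis nonzero_mult_div_cancel_left)
  qed
qed

section \<open>Cauchy transforms of probability measures\<close>

lemma nonreal_minus_real: "z \<notin> \<real> \<Longrightarrow> z - complex_of_real t \<noteq> 0"
  by auto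

lemma norm_resolvent_le:
  assumes "z \<notin> \<real>"
  shows "norm (1 / (z - complex_of_real t)) \<le> 1 / \<bar>Im z\<bar>"
proof -
  have "0 < \<bar>Im z\<bar>" using assms by (simp add: complex_is_Real_iff)
  moreover have "\<bar>Im z\<bar> \<le> norm (z - complex_of_real t)"
    using abs_Im_le_cmod[of "z - complex_of_real t"] by simp
  ultimately show ?thesis by (simp add: norm_divide frac_le)
qed

lemma isCont_resolvent:
  assumes "z \<notin> \<real>"
  shows "isCont (\<lambda>t. 1 / (z - complex_of_real t)) t"
  using nonreal_minus_real[OF assms] by (intro continuous_intros) auto

lemma Im_resolvent:
  "Im (1 / (Complex x y - complex_of_real t)) = - pi * poisson_kernel y x t"
  by (simp add: poisson_kernel_def Im_divide power2_commute)

context real_distribution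
begin

lemma integrable_resolvent:
  assumes "z \<notin> \<real>"
  shows "integrable M (\<lambda>t. 1 / (z - complex_of_real t))"
  by (rule integrable_const_bound[where B="1 / \<bar>Im z\<bar>"])
    (use norm_resolvent_le[OF assms] in auto)

lemma poisson_kernel_eq_Im_cauchy_transform:
  assumes "0 < y"
  shows "(\<integral>\<^sup>+t. ennreal (poisson_kernel y x t) \<partial>M) = ennreal (- Im (cauchy_transform M (Complex x y)) / pi)"
proof -
  have z: "Complex x y \<notin> \<real>" using assms by (simp add: complex_is_Real_iff)
  have int: "integrable M (\<lambda>t. - Im (1 / (Complex x y - complex_of_real t)) / pi)"
    using integrable_Im[OF integrable_resolvent[OF z]] by simp
  have "(\<integral>\<^sup>+t. ennreal (poisson_kernel y x t) \<partial>M)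
      = (\<integral>\<^sup>+t. ennreal (- Im (1 / (Complex x y - complex_of_real t)) / pi) \<partial>M)"
    by (simp only: Im_resolvent) simp
  also have "\<dots> = ennreal (\<integral>t. - Im (1 / (Complex x y - complex_of_real t)) / pi \<partial>M)"
    by (rule nn_integral_eq_integral[OF int])
      (use assms in \<open>simp only: Im_resolvent, simp add: poisson_kernel_nonneg\<close>)
  also have "(\<integral>t. - Im (1 / (Complex x y - complex_of_real t)) / pi \<partial>M)
      = - Im (cauchy_transform M (Complex x y)) / pi"
    unfolding cauchy_transform_def
    using integral_Im[OF integrable_resolvent[OF z]] by simp
  finally show ?thesis .
qed

lemma Im_cauchy_transform_neg:
  assumes "0 < Im z"
  shows "Im (cauchy_transform M z) < 0"
proof -
  have z: "z \<notin> \<real>" using assms by (simp add: complex_is_Real_iff)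
  have pos: "0 < - Im (1 / (z - complex_of_real t))" for t
    using Im_resolvent[of "Re z" "Im z" t] poisson_kernel_pos[OF assms, of "Re z" t] by simp
  have int: "integrable M (\<lambda>t. - Im (1 / (z - complex_of_real t)))"
    using integrable_Im[OF integrable_resolvent[OF z]] by simp
  have "(\<integral>t. - Im (1 / (z - complex_of_real t)) \<partial>M) \<noteq> 0"
  proof
    assume "(\<integral>t. - Im (1 / (z - complex_of_real t)) \<partial>M) = 0"
    then have "AE t in M. - Im (1 / (z - complex_of_real t)) = 0"
      using integral_nonneg_eq_0_iff_AE[OF int] pos by (auto intro: less_imp_le)
    then have "AE t in M. False" by eventually_elim (metis pos less_irrefl)
    then show False using prob_space by (simp add: AE_False emeasure_space_1)
  qed
  moreover have "0 \<le> (\<integral>t. - Im (1 / (z - complex_of_real t)) \<partial>M)"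
    using pos by (intro Bochner_Integration.integral_nonneg) (auto intro: less_imp_le)
  ultimately have "0 < (\<integral>t. - Im (1 / (z - complex_of_real t)) \<partial>M)" by simp
  then show ?thesis
    unfolding cauchy_transform_def
    using integral_Im[OF integrable_resolvent[OF z]] by simp
qed

lemma cauchy_transform_cnj: "cauchy_transform M (cnj z) = cnj (cauchy_transform M z)"
proof -
  have "cauchy_transform M (cnj z) = (\<integral>t. cnj (1 / (z - complex_of_real t)) \<partial>M)"
    by (simp add: cauchy_transform_def)
  then show ?thesis unfolding cauchy_transform_def by (simp only: Bochner_Integration.integral_cnj)
qed

lemma Im_cauchy_transform_nonzero:
  assumes "z \<notin> \<real>"
  shows "Im (cauchy_transform M z) \<noteq> 0"
proof (cases "0 < Im z")
  case True
  then show ?thesis using Im_cauchy_transform_neg[of z] by simp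
next
  case False
  then have "0 < Im (cnj z)" using assms by (simp add: complex_is_Real_iff)
  from Im_cauchy_transform_neg[OF this] show ?thesis by (simp add: cauchy_transform_cnj)
qed

text \<open>The quantity \<open>1 + y Im (G (\<i> y))\<close> is the integral of \<open>t\<^sup>2 / (t\<^sup>2 + y\<^sup>2)\<close>, which is at least \<open>1/2\<close> outside
  the interval. This bound is the source of tightness below.\<close>

lemma measure_outside_le_Im_cauchy_transform:
  assumes y: "0 < y"
  shows "1 - measure M {- y<..y} \<le> 2 * (1 + y * Im (cauchy_transform M (Complex 0 y)))"
proof -
  have z: "Complex 0 y \<notin> \<real>" using y by (simp add: complex_is_Real_iff)
  let ?f = "\<lambda>t. 1 + y * Im (1 / (Complex 0 y - complex_of_real t))"
  have pos: "0 < t\<^sup>2 + y\<^sup>2" for t using y by (intro add_nonneg_pos) auto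
  have f: "?f t = t\<^sup>2 / (t\<^sup>2 + y\<^sup>2)" for t
  proof -
    have "?f t = 1 - y\<^sup>2 / (t\<^sup>2 + y\<^sup>2)" by (simp add: Im_divide power2_eq_square)
    also have "\<dots> = t\<^sup>2 / (t\<^sup>2 + y\<^sup>2)" using y pos[of t] by (simp add: divide_simps)
    finally show ?thesis .
  qed
  have le: "indicator (UNIV - {- y<..y}) t \<le> 2 * ?f t" for t
  proof (cases "t \<in> {- y<..y}")
    case False
    then have "\<bar>y\<bar> \<le> \<bar>t\<bar>" using y by auto
    then have "y\<^sup>2 \<le> t\<^sup>2" by (simp add: abs_le_square_iff)
    then show ?thesis using False pos[of t] by (simp add: f field_simps)
  qed (simp add: f)
  have int: "integrable M ?f"
    using integrable_Im[OF integrable_resolvent[OF z]] by simp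
  have "1 - measure M {- y<..y} = measure M (UNIV - {- y<..y})"
    using prob_compl[of "{- y<..y}"] by simp
  also have "\<dots> = (\<integral>t. indicator (UNIV - {- y<..y}) t \<partial>M)" by simp
  also have "\<dots> \<le> (\<integral>t. 2 * ?f t \<partial>M)"
  proof (rule integral_mono)
    show "integrable M (\<lambda>t. 2 * ?f t)" using int by (intro integrable_mult_right)
  qed (use le in \<open>auto simp: less_top[symmetric]\<close>)
  also have "\<dots> = 2 * (1 + y * Im (cauchy_transform M (Complex 0 y)))"
    unfolding cauchy_transform_def
    using integral_Im[OF integrable_resolvent[OF z]] integrable_Im[OF integrable_resolvent[OF z]]
      prob_space
    by simp
  finally show ?thesis .
qed

lemma cauchy_transform_asymptotics:
  "(\<lambda>n. Complex 0 (real (Suc n)) * cauchy_transform M (Complex 0 (real (Suc n)))) \<longlonglongrightarrow> 1"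
proof -
  have z: "Complex 0 (real (Suc n)) \<notin> \<real>" for n by (simp add: complex_is_Real_iff)
  have "(\<lambda>n. \<integral>t. Complex 0 (real (Suc n)) * (1 / (Complex 0 (real (Suc n)) - complex_of_real t)) \<partial>M)
    \<longlonglongrightarrow> (\<integral>t. 1 \<partial>M)"
  proof (rule integral_dominated_convergence[where w="\<lambda>_. 1"])
    show "AE t in M. norm (Complex 0 (real (Suc n)) * (1 / (Complex 0 (real (Suc n)) - complex_of_real t))) \<le> 1" for n
    proof (intro AE_I2)
      fix t
      have "norm (Complex 0 (real (Suc n)) * (1 / (Complex 0 (real (Suc n)) - complex_of_real t)))
        \<le> norm (Complex 0 (real (Suc n))) * (1 / \<bar>Im (Complex 0 (real (Suc n)))\<bar>)"
        unfolding norm_mult by (intro mult_left_mono norm_resolvent_le z) auto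
      also have "\<dots> = 1" by (simp add: complex_norm)
      finally show "norm (Complex 0 (real (Suc n)) * (1 / (Complex 0 (real (Suc n)) - complex_of_real t))) \<le> 1" .
    qed
    have "(\<lambda>n. Complex 0 (real (Suc n)) * (1 / (Complex 0 (real (Suc n)) - complex_of_real t))) \<longlonglongrightarrow> 1" for t
    proof -
      have eq: "Complex 0 (real (Suc n)) * (1 / (Complex 0 (real (Suc n)) - complex_of_real t))
        = 1 / (1 + \<i> * of_real (t / real (Suc n)))" for n
        using nonreal_minus_real[OF z[of n], of t]
        by (auto simp: complex_eq_iff Re_divide Im_divide power2_eq_square divide_simps)
      have "(\<lambda>n. t / real (Suc n)) \<longlonglongrightarrow> 0" by real_asymp
      then have "(\<lambda>n. 1 / (1 + \<i> * complex_of_real (t / real (Suc n)))) \<longlonglongrightarrow> 1 / (1 + \<i> * of_real 0)"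
        by (intro tendsto_intros) auto
      then show ?thesis unfolding eq by simp
    qed
    then show "AE t in M. (\<lambda>n. Complex 0 (real (Suc n)) * (1 / (Complex 0 (real (Suc n)) - complex_of_real t))) \<longlonglongrightarrow> 1"
      by simp
  qed auto
  moreover have "(\<integral>t. 1 \<partial>M) = (1 :: complex)" using prob_space by simp
  ultimately show ?thesis
    unfolding cauchy_transform_def by (simp only: integral_mult_right_zero)
qed

end

text \<open>Up to a constant factor the imaginary parts of the transforms are the Poisson integrals, and these
  determine the measure.\<close>

theorem real_distribution_eqI_cauchy_transform:
  assumes "real_distribution M" "real_distribution N"
    and eq: "\<And>z. z \<notin> \<real> \<Longrightarrow> cauchy_transform M z = cauchy_transform N z"
  shows "M = N"
proof -
  interpret M: real_distribution M by fact
  interpret N: real_distribution N by fact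
  have z: "Complex x y \<notin> \<real>" if "0 < y" for x y using that by (simp add: complex_is_Real_iff)
  show ?thesis
    by (rule measure_eqI_poisson)
      (simp_all add: M.poisson_kernel_eq_Im_cauchy_transform N.poisson_kernel_eq_Im_cauchy_transform eq z)
qed

section \<open>Rank-one perturbation of a probability measure\<close>

text \<open>The hypothesis on \<open>H\<close> says that no mass escapes to infinity in the limit. It controls all but finitely
  many members of the sequence; the remaining ones are tight one by one.\<close>

lemma tight_if_cauchy_transforms_tendsto:
  assumes \<mu>: "\<And>n. real_distribution (\<mu> n)"
    and lim: "\<And>y. 0 < y \<Longrightarrow> (\<lambda>n. cauchy_transform (\<mu> n) (Complex 0 y)) \<longlonglongrightarrow> H y"
    and H: "(\<lambda>k. real (Suc k) * Im (H (real (Suc k)))) \<longlonglongrightarrow> -1"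
  shows "tight \<mu>"
  unfolding tight_def
proof safe
  show "real_distribution (\<mu> n)" for n by (rule \<mu>)
  fix \<epsilon> :: real assume \<epsilon>: "0 < \<epsilon>"
  have "(\<lambda>k. 2 * (1 + real (Suc k) * Im (H (real (Suc k))))) \<longlonglongrightarrow> 2 * (1 + -1)"
    by (intro tendsto_intros H)
  then have "eventually (\<lambda>k. 2 * (1 + real (Suc k) * Im (H (real (Suc k)))) < \<epsilon>) sequentially"
    using \<epsilon> by (intro order_tendstoD(2)) auto
  then obtain k where k: "2 * (1 + real (Suc k) * Im (H (real (Suc k)))) < \<epsilon>"
    by (auto simp: eventually_sequentially)
  define y where "y = real (Suc k)"
  have y: "0 < y" by (simp add: y_def)
  have "(\<lambda>n. 2 * (1 + y * Im (cauchy_transform (\<mu> n) (Complex 0 y)))) \<longlonglongrightarrow> 2 * (1 + y * Im (H y))"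
    by (intro tendsto_intros lim y)
  then have "eventually (\<lambda>n. 2 * (1 + y * Im (cauchy_transform (\<mu> n) (Complex 0 y))) < \<epsilon>) sequentially"
    using k by (intro order_tendstoD(2)) (auto simp: y_def)
  then obtain N where N: "\<And>n. N \<le> n \<Longrightarrow> 2 * (1 + y * Im (cauchy_transform (\<mu> n) (Complex 0 y))) < \<epsilon>"
    by (auto simp: eventually_sequentially)
  have large: "1 - \<epsilon> < measure (\<mu> n) {- b<..b}" if "N \<le> n" "y \<le> b" for n b
  proof -
    interpret real_distribution "\<mu> n" by (rule \<mu>)
    have "1 - \<epsilon> < measure (\<mu> n) {- y<..y}"
      using measure_outside_le_Im_cauchy_transform[OF y] N[OF that(1)] by linarith
    also have "\<dots> \<le> measure (\<mu> n) {- b<..b}" using that by (intro finite_measure_mono) auto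
    finally show ?thesis .
  qed
  have "eventually (\<lambda>m. 1 - \<epsilon> < measure (\<mu> n) {- real m<..real m}) sequentially" for n
  proof -
    interpret real_distribution "\<mu> n" by (rule \<mu>)
    have "(\<lambda>m. measure (\<mu> n) {- real m<..real m}) \<longlonglongrightarrow> measure (\<mu> n) (\<Union>m. {- real m<..real m})"
      by (rule finite_Lim_measure_incseq) (auto simp: incseq_def)
    also have "(\<Union>m. {- real m<..real m}) = UNIV"
    proof -
      have "\<exists>m. x \<in> {- real m<..real m}" for x
      proof -
        obtain m where "\<bar>x\<bar> < real m" using reals_Archimedean2 by blast
        then show ?thesis by (intro exI[of _ m]) auto
      qed
      then show ?thesis by blast
    qed
    finally have "(\<lambda>m. measure (\<mu> n) {- real m<..real m}) \<longlonglongrightarrow> 1" using prob_space by simp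
    then show ?thesis using \<epsilon> by (intro order_tendstoD(1)) auto
  qed
  then have "eventually (\<lambda>m. \<forall>n\<in>{..<N}. 1 - \<epsilon> < measure (\<mu> n) {- real m<..real m}) sequentially"
    by (intro eventually_ball_finite) auto
  moreover have "eventually (\<lambda>m. y \<le> real m) sequentially"
    using y_def by (intro eventually_sequentiallyI[of "Suc k"]) simp
  ultimately have "eventually (\<lambda>m. y \<le> real m \<and> (\<forall>n\<in>{..<N}. 1 - \<epsilon> < measure (\<mu> n) {- real m<..real m})) sequentially"
    by eventually_elim simp
  then obtain m where m: "y \<le> real m" "\<forall>n\<in>{..<N}. 1 - \<epsilon> < measure (\<mu> n) {- real m<..real m}"
    by (auto simp: eventually_sequentially)
  have "1 - \<epsilon> < measure (\<mu> n) {- real m<..real m}" for n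
    using m large[of n "real m"] by (cases "n < N") auto
  moreover have "- real m < real m" using m(1) y by linarith
  ultimately show "\<exists>a b. a < b \<and> (\<forall>n. 1 - \<epsilon> < measure (\<mu> n) {a<..b})" by blast
qed

lemma finite_point_masses:
  fixes c :: "real \<Rightarrow> real"
  assumes Z: "finite Z" and c: "\<And>r. r \<in> Z \<Longrightarrow> 0 < c r" and sum: "sum c Z = 1"
  obtains \<mu> where "real_distribution \<mu>"
    "\<And>z. cauchy_transform \<mu> z = (\<Sum>r\<in>Z. of_real (c r) / (z - of_real r))"
proof -
  define f where "f r = (if r \<in> Z then c r else 0)" for r
  have f0: "0 \<le> f r" for r using c by (auto simp: f_def intro: less_imp_le)
  have "(\<integral>\<^sup>+r. ennreal (f r) \<partial>count_space UNIV) = (\<Sum>r\<in>Z. ennreal (f r))"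
    using Z by (intro nn_integral_count_space'[OF Z]) (auto simp: f_def)
  also have "\<dots> = ennreal (sum f Z)" using f0 by (intro sum_ennreal)
  also have "sum f Z = 1" using sum by (simp add: f_def)
  finally have f1: "(\<integral>\<^sup>+r. ennreal (f r) \<partial>count_space UNIV) = 1" by simp
  define p where "p = embed_pmf f"
  have p: "pmf p r = f r" for r unfolding p_def by (rule pmf_embed_pmf[OF f0 f1])
  define \<mu> where "\<mu> = distr (measure_pmf p) borel (\<lambda>r. r)"
  show thesis
  proof
    show "real_distribution \<mu>"
      unfolding \<mu>_def by (rule prob_space.real_distribution_distr[OF prob_space_measure_pmf]) simp
    fix z
    have "cauchy_transform \<mu> z = (\<integral>r. 1 / (z - complex_of_real r) \<partial>measure_pmf p)"
      unfolding cauchy_transform_def \<mu>_def by (rule integral_distr) auto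
    also have "\<dots> = (\<Sum>r\<in>Z. pmf p r *\<^sub>R (1 / (z - complex_of_real r)))"
      using Z by (rule integral_measure_pmf) (auto simp: set_pmf_iff p f_def split: if_splits)
    also have "\<dots> = (\<Sum>r\<in>Z. of_real (c r) / (z - of_real r))"
      by (rule sum.cong) (auto simp: p f_def scaleR_conv_of_real)
    finally show "cauchy_transform \<mu> z = (\<Sum>r\<in>Z. of_real (c r) / (z - of_real r))" .
  qed
qed

lemma (in prob_space) cauchy_transform_finite_range:
  fixes q :: "'a \<Rightarrow> real"
  assumes q: "simple_function M q"
  obtains S w where "finite S" "\<And>t. t \<in> S \<Longrightarrow> 0 < w t" "sum w S = (1::real)"
    "\<And>z. cauchy_transform (distr M borel q) z = (\<Sum>t\<in>S. of_real (w t) / (z - of_real t))"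
proof -
  note [measurable] = borel_measurable_simple_function[OF q]
  define T where "T = q ` space M"
  have T: "finite T" using q by (simp add: T_def simple_function_def)
  define w where "w t = measure M (q -` {t} \<inter> space M)" for t
  have meas: "q -` {t} \<inter> space M \<in> sets M" for t by measurable
  have int: "(\<integral>x. h (q x) \<partial>M) = (\<Sum>t\<in>T. w t *\<^sub>R h t)" for h :: "real \<Rightarrow> complex"
  proof -
    have "(\<integral>x. h (q x) \<partial>M) = (\<integral>x. (\<Sum>t\<in>T. indicator (q -` {t} \<inter> space M) x *\<^sub>R h t) \<partial>M)"
    proof (rule Bochner_Integration.integral_cong)
      fix x assume x: "x \<in> space M"
      then have "(\<Sum>t\<in>T. indicator (q -` {t} \<inter> space M) x *\<^sub>R h t) = (\<Sum>t\<in>T. if q x = t then h t else 0)"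
        by (intro sum.cong) (auto simp: indicator_def)
      also have "\<dots> = h (q x)" using T x by (simp add: T_def)
      finally show "h (q x) = (\<Sum>t\<in>T. indicator (q -` {t} \<inter> space M) x *\<^sub>R h t)" by simp
    qed simp
    also have "\<dots> = (\<Sum>t\<in>T. w t *\<^sub>R h t)"
      using meas by (subst Bochner_Integration.integral_sum) (auto simp: w_def less_top[symmetric])
    finally show ?thesis .
  qed
  define S where "S = {t \<in> T. 0 < w t}"
  have S: "finite S" "S \<subseteq> T" using T by (auto simp: S_def)
  have w0: "w t = 0" if "t \<in> T - S" for t
    using that measure_nonneg[of M "q -` {t} \<inter> space M"] unfolding S_def w_def by (simp add: not_less order_antisym)
  show thesis
  proof (rule that[of S w])
    show "finite S" by fact
    show "0 < w t" if "t \<in> S" for t using that by (simp add: S_def)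
    have "complex_of_real (sum w T) = complex_of_real 1"
      using int[of "\<lambda>_. 1"] by (simp add: scaleR_conv_of_real prob_space)
    then have "sum w T = 1" by (simp only: of_real_eq_iff)
    then show "sum w S = 1" using sum.mono_neutral_left[OF T S(2), of w] w0 by auto
    fix z
    have "cauchy_transform (distr M borel q) z = (\<integral>x. 1 / (z - of_real (q x)) \<partial>M)"
      unfolding cauchy_transform_def by (rule integral_distr) auto
    also have "\<dots> = (\<Sum>t\<in>T. w t *\<^sub>R (1 / (z - of_real t)))" by (rule int)
    also have "\<dots> = (\<Sum>t\<in>S. w t *\<^sub>R (1 / (z - of_real t)))"
      by (rule sum.mono_neutral_right[OF T S(2)]) (simp add: w0)
    finally show "cauchy_transform (distr M borel q) z = (\<Sum>t\<in>S. of_real (w t) / (z - of_real t))"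
      by (simp add: scaleR_conv_of_real)
  qed
qed

text \<open>The measure is approximated by the distributions of simple functions converging to the identity, for
  which the perturbed measures are known. Their transforms converge, and the limit \<open>H\<close> still satisfies
  \<open>\<i> y H (\<i> y) \<longlonglongrightarrow> 1\<close>; so the perturbed measures are tight, and a weak limit point has the transform \<open>H\<close>.\<close>

theorem (in real_distribution) rank_one_perturbation:
  obtains \<mu> where "real_distribution \<mu>"
    "\<And>z. z \<notin> \<real> \<Longrightarrow> cauchy_transform \<mu> z = cauchy_transform M z / (1 - of_real x * cauchy_transform M z)"
proof -
  have "(\<lambda>t. t) \<in> borel_measurable M" by simp
  then obtain q where q: "\<And>n. simple_function M (q n)" "\<And>t. (\<lambda>n. q n t) \<longlonglongrightarrow> t"
    using borel_measurable_implies_sequence_metric[of "\<lambda>t. t" M 0] by auto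
  note [measurable] = borel_measurable_simple_function[OF q(1)]
  define G where "G n = cauchy_transform (distr M borel (q n))" for n
  define H where "H z = cauchy_transform M z / (1 - of_real x * cauchy_transform M z)" for z
  have G: "(\<lambda>n. G n z) \<longlonglongrightarrow> cauchy_transform M z" if z: "z \<notin> \<real>" for z
  proof -
    have "(\<lambda>n. \<integral>t. 1 / (z - of_real (q n t)) \<partial>M) \<longlonglongrightarrow> (\<integral>t. 1 / (z - of_real t) \<partial>M)"
    proof (rule integral_dominated_convergence[where w="\<lambda>_. 1 / \<bar>Im z\<bar>"])
      show "AE t in M. (\<lambda>n. 1 / (z - of_real (q n t))) \<longlonglongrightarrow> 1 / (z - of_real t)"
        using q(2) nonreal_minus_real[OF z] by (intro AE_I2 tendsto_intros) auto
      show "AE t in M. norm (1 / (z - of_real (q n t))) \<le> 1 / \<bar>Im z\<bar>" for n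
        using norm_resolvent_le[OF z] by auto
    qed auto
    moreover have "G n z = (\<integral>t. 1 / (z - of_real (q n t)) \<partial>M)" for n
      unfolding G_def cauchy_transform_def by (rule integral_distr) auto
    ultimately show ?thesis unfolding cauchy_transform_def by simp
  qed
  have den: "1 - of_real x * cauchy_transform M z \<noteq> 0" if z: "z \<notin> \<real>" for z
  proof
    assume "1 - of_real x * cauchy_transform M z = 0"
    then have "Im (of_real x * cauchy_transform M z) = 0" "Re (of_real x * cauchy_transform M z) = 1"
      by (auto simp: complex_eq_iff)
    then show False using Im_cauchy_transform_nonzero[OF z] by auto
  qed
  have "\<exists>\<mu>. real_distribution \<mu> \<and> (\<forall>z. z \<notin> \<real> \<longrightarrow> cauchy_transform \<mu> z = G n z / (1 - of_real x * G n z))" for n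
  proof -
    obtain S w where S: "finite S" "\<And>t. t \<in> S \<Longrightarrow> 0 < w t" "sum w S = (1::real)"
      and GS: "\<And>z. G n z = (\<Sum>t\<in>S. of_real (w t) / (z - of_real t))"
      unfolding G_def by (rule cauchy_transform_finite_range[OF q(1)]) blast
    obtain Z c where Z: "finite Z" "\<And>r. r \<in> Z \<Longrightarrow> 0 < c r" "sum c Z = (1::real)"
      and ZG: "\<And>z. z \<notin> \<real> \<Longrightarrow> (\<Sum>r\<in>Z. of_real (c r) / (z - of_real r)) = G n z / (1 - of_real x * G n z)"
      unfolding GS by (rule rank_one_perturbation_finite[OF S, of x]) blast+
    obtain \<mu> where "real_distribution \<mu>" "\<And>z. cauchy_transform \<mu> z = (\<Sum>r\<in>Z. of_real (c r) / (z - of_real r))"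
      by (rule finite_point_masses[OF Z]) blast+
    then show ?thesis using ZG by auto
  qed
  then obtain \<mu> where \<mu>: "\<And>n. real_distribution (\<mu> n)"
    and \<mu>G: "\<And>n z. z \<notin> \<real> \<Longrightarrow> cauchy_transform (\<mu> n) z = G n z / (1 - of_real x * G n z)"
    by metis
  have lim: "(\<lambda>n. cauchy_transform (\<mu> n) z) \<longlonglongrightarrow> H z" if z: "z \<notin> \<real>" for z
    unfolding \<mu>G[OF z] H_def by (intro tendsto_intros G z den)
  have "tight \<mu>"
  proof (rule tight_if_cauchy_transforms_tendsto[where H="\<lambda>y. H (Complex 0 y)"])
    show "real_distribution (\<mu> n)" for n by (rule \<mu>)
    show "(\<lambda>n. cauchy_transform (\<mu> n) (Complex 0 y)) \<longlonglongrightarrow> H (Complex 0 y)" if "0 < y" for y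
      using that by (intro lim) (simp add: complex_is_Real_iff)
    define z where "z k = Complex 0 (real (Suc k))" for k
    define a where "a k = z k * cauchy_transform M (z k)" for k
    have a: "a \<longlonglongrightarrow> 1" unfolding a_def z_def by (rule cauchy_transform_asymptotics)
    have zk: "z k \<noteq> 0" for k by (simp add: z_def complex_eq_iff)
    have "(\<lambda>k. norm (1 / z k)) \<longlonglongrightarrow> 0"
    proof -
      have "norm (1 / z k) = 1 / real (Suc k)" for k by (simp add: z_def norm_divide complex_norm)
      then show ?thesis using lim_inverse_n' LIMSEQ_Suc by (simp only: ) (rule LIMSEQ_Suc[OF lim_inverse_n'])
    qed
    then have z0: "(\<lambda>k. 1 / z k) \<longlonglongrightarrow> 0" by (rule tendsto_norm_zero_cancel)
    have "(\<lambda>k. a k / (1 - of_real x * (a k * (1 / z k)))) \<longlonglongrightarrow> 1 / (1 - of_real x * (1 * 0))"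
      by (intro tendsto_intros a z0) auto
    then have "(\<lambda>k. z k * H (z k)) \<longlonglongrightarrow> 1" using zk by (simp add: a_def H_def)
    from tendsto_minus[OF tendsto_Re[OF this]]
    show "(\<lambda>k. real (Suc k) * Im (H (Complex 0 (real (Suc k))))) \<longlonglongrightarrow> -1" by (simp add: z_def)
  qed
  from tight_imp_convergent_subsubsequence[OF this strict_mono_id]
  obtain r N where r: "strict_mono r" and N: "real_distribution N" and weak: "weak_conv_m (\<mu> \<circ> id \<circ> r) N"
    by auto
  show thesis
  proof (rule that[OF N])
    fix z :: complex assume z: "z \<notin> \<real>"
    have "(\<lambda>k. cauchy_transform ((\<mu> \<circ> id \<circ> r) k) z) \<longlonglongrightarrow> cauchy_transform N z"
      unfolding cauchy_transform_def
      by (rule weak_conv_imp_integral_bdd_continuous_conv[OF _ N weak])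
        (use \<mu> isCont_resolvent[OF z] norm_resolvent_le[OF z] in auto)
    moreover have "(\<lambda>k. cauchy_transform ((\<mu> \<circ> id \<circ> r) k) z) \<longlonglongrightarrow> H z"
      using LIMSEQ_subseq_LIMSEQ[OF lim[OF z] r] by (simp add: o_def)
    ultimately show "cauchy_transform N z = cauchy_transform M z / (1 - of_real x * cauchy_transform M z)"
      using LIMSEQ_unique H_def by metis
  qed
qed

section \<open>Markov kernels preserving the Lebesgue measure\<close>

text \<open>The tangent inequality of a convex function, stated with the boundary point \<open>a = 0\<close> included, so that
  the next lemma applies to variables which vanish on a set of positive probability.\<close>

lemma powr_above_tangent:
  fixes a m q :: real
  assumes m: "0 < m" and a: "0 \<le> a" and q: "1 \<le> q"
  shows "m powr q + q * m powr (q - 1) * (a - m) \<le> a powr q"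
proof (cases "a = 0")
  case True
  have "m powr q = m powr (q - 1) * m" using m by (simp add: powr_mult_base' powr_diff)
  then have "m powr q + q * m powr (q - 1) * (a - m) = (1 - q) * m powr q"
    using True by (simp add: algebra_simps)
  also have "\<dots> \<le> 0" using q by (intro mult_nonpos_nonneg) auto
  finally show ?thesis using True by simp
next
  case False
  have "q * m powr (q - 1) * (a - m) \<le> a powr q - m powr q"
  proof (rule convex_on_imp_above_tangent[OF powr_convex[OF q]])
    show "((\<lambda>x. x powr q) has_real_derivative q * m powr (q - 1)) (at m within {0<..})"
      using m by (intro has_field_derivative_at_within[OF has_real_derivative_powr])
  qed (use m a False in \<open>auto simp: interior_open\<close>)
  then show ?thesis by simp
qed

text \<open>Jensen's inequality: integrate the tangent inequality at the expectation.\<close>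

lemma (in prob_space) powr_expectation_le:
  fixes X :: "'a \<Rightarrow> real"
  assumes q: "1 \<le> q" and X: "\<And>x. 0 \<le> X x"
    and int: "integrable M X" "integrable M (\<lambda>x. X x powr q)"
  shows "expectation X powr q \<le> expectation (\<lambda>x. X x powr q)"
proof (cases "expectation X = 0")
  case True
  then show ?thesis by (auto intro!: Bochner_Integration.integral_nonneg)
next
  case False
  define m where "m = expectation X"
  have m: "0 < m" using False X by (simp add: m_def order_less_le integral_nonneg)
  have "expectation (\<lambda>x. m powr q + q * m powr (q - 1) * (X x - m)) \<le> expectation (\<lambda>x. X x powr q)"
    using int X powr_above_tangent[OF m _ q] by (intro integral_mono) auto
  also have "expectation (\<lambda>x. m powr q + q * m powr (q - 1) * (X x - m)) = m powr q"
    using int(1) by (simp add: prob_space m_def)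
  finally show ?thesis by (simp add: m_def)
qed

text \<open>A Markov kernel with \<open>\<integral> \<kappa> x dx = dx\<close>. By Jensen's inequality for each \<open>\<kappa> x\<close> and invariance, the averaging
  operator of such a kernel is a contraction on every \<open>L\<^sup>p\<close>.\<close>

locale lebesgue_invariant_kernel =
  fixes \<kappa> :: "real \<Rightarrow> real measure"
  assumes kernel: "\<kappa> \<in> borel \<rightarrow>\<^sub>M prob_algebra borel"
    and invariant: "lborel \<bind> \<kappa> = lborel"
begin

definition transition :: "(real \<Rightarrow> complex) \<Rightarrow> real \<Rightarrow> complex" where
  "transition f x = (\<integral>y. f y \<partial>\<kappa> x)"

lemma subprob_kernel [measurable]: "\<kappa> \<in> lborel \<rightarrow>\<^sub>M subprob_algebra borel"
  using measurable_prob_algebraD[OF kernel] by (simp cong: measurable_cong_sets)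

lemma sets_kernel [simp, measurable_cong]: "sets (\<kappa> x) = sets borel"
  using measurable_space[OF kernel, of x] by (simp add: space_prob_algebra)

lemma prob_space_kernel: "prob_space (\<kappa> x)"
  using measurable_space[OF kernel, of x] by (simp add: space_prob_algebra)

lemma nn_integral_kernel:
  assumes "f \<in> borel_measurable borel"
  shows "(\<integral>\<^sup>+x. \<integral>\<^sup>+y. f y \<partial>\<kappa> x \<partial>lborel) = (\<integral>\<^sup>+x. f x \<partial>lborel)"
  using nn_integral_bind[OF assms subprob_kernel] by (simp add: invariant)

text \<open>Null sets of the Lebesgue measure are null for almost every \<open>\<kappa> x\<close>, which is what makes the operator
  well defined on almost-everywhere classes.\<close>

lemma AE_kernel:
  assumes "Measurable.pred borel P" "AE x in lborel. P x"
  shows "AE x in lborel. AE y in \<kappa> x. P y"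
  using AE_bind[OF subprob_kernel assms(1)] assms(2) unfolding invariant by simp

lemma borel_measurable_nn_integral_kernel [measurable]:
  assumes "f \<in> borel_measurable borel"
  shows "(\<lambda>x. \<integral>\<^sup>+y. f y \<partial>\<kappa> x) \<in> borel_measurable lborel"
  by (rule measurable_compose[OF subprob_kernel nn_integral_measurable_subprob_algebra[OF assms]])

lemma borel_measurable_transition:
  assumes "f \<in> borel_measurable borel"
  shows "transition f \<in> borel_measurable borel"
  unfolding transition_def
  using measurable_compose[OF subprob_kernel integral_measurable_subprob_algebra[OF assms]] by simp

lemma AE_norm_le_esssup:
  fixes f :: "real \<Rightarrow> complex"
  assumes "f \<in> borel_measurable borel"
  shows "AE x in lborel. AE y in \<kappa> x. ennreal (norm (f y)) \<le> esssup lborel (\<lambda>y. ennreal (norm (f y)))"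
  using assms by (intro AE_kernel esssup_AE) measurable

lemma AE_powr_integral_finite:
  fixes f :: "real \<Rightarrow> complex"
  assumes f: "f \<in> borel_measurable borel" and int: "integrable lborel (\<lambda>x. norm (f x) powr q)"
  shows "AE x in lborel. (\<integral>\<^sup>+y. ennreal (norm (f y) powr q) \<partial>\<kappa> x) < \<infinity>"
proof -
  note [measurable] = f
  have "(\<integral>\<^sup>+x. \<integral>\<^sup>+y. ennreal (norm (f y) powr q) \<partial>\<kappa> x \<partial>lborel) = (\<integral>\<^sup>+x. ennreal (norm (f x) powr q) \<partial>lborel)"
    by (rule nn_integral_kernel) measurable
  also have "\<dots> < \<infinity>" using int by (simp add: integrable_iff_bounded)
  finally have "AE x in lborel. (\<integral>\<^sup>+y. ennreal (norm (f y) powr q) \<partial>\<kappa> x) \<noteq> \<infinity>"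
    by (intro nn_integral_noteq_infinite) auto
  then show ?thesis by eventually_elim (simp add: less_top)
qed

lemma integrable_if_powr_integrable:
  fixes f :: "real \<Rightarrow> complex"
  assumes f: "f \<in> borel_measurable borel" and q: "1 \<le> q"
    and fin: "(\<integral>\<^sup>+y. ennreal (norm (f y) powr q) \<partial>\<kappa> x) < \<infinity>"
  shows "integrable (\<kappa> x) (\<lambda>y. norm (f y) powr q)" and "integrable (\<kappa> x) f"
proof -
  note [measurable] = f
  interpret prob_space "\<kappa> x" by (rule prob_space_kernel)
  show *: "integrable (\<kappa> x) (\<lambda>y. norm (f y) powr q)"
    using fin by (intro integrableI_nonneg) auto
  have le: "a \<le> 1 + a powr q" if "0 \<le> a" for a :: real
  proof (cases "a \<le> 1")
    case False
    then have "a powr 1 \<le> a powr q" using q by (intro powr_mono) auto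
    then show ?thesis using False by simp
  qed (simp add: add_increasing2)
  show "integrable (\<kappa> x) f"
  proof (rule Bochner_Integration.integrable_bound)
    show "integrable (\<kappa> x) (\<lambda>y. 1 + norm (f y) powr q)" using * by simp
    show "AE y in \<kappa> x. norm (f y) \<le> norm (1 + norm (f y) powr q)"
      using le by (auto simp: abs_of_nonneg)
  qed measurable
qed

theorem AE_integrable_kernel:
  assumes f: "f \<in> Lp_space p" and p: "1 \<le> p"
  shows "AE x in lborel. integrable (\<kappa> x) f"
proof -
  have fm [measurable]: "f \<in> borel_measurable borel" using f by (simp add: Lp_space_def)
  show ?thesis
  proof (cases "p = \<infinity>")
    case True
    define c where "c = esssup lborel (\<lambda>y. ennreal (norm (f y)))"
    have c: "c < \<infinity>" using f True by (simp add: Lp_space_def c_def)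
    have "AE x in lborel. AE y in \<kappa> x. ennreal (norm (f y)) \<le> c"
      using AE_norm_le_esssup[OF fm] by (simp add: c_def)
    then show ?thesis
    proof eventually_elim
      case (elim x)
      interpret prob_space "\<kappa> x" by (rule prob_space_kernel)
      have "AE y in \<kappa> x. norm (f y) \<le> enn2real c"
        using elim by eventually_elim (metis c enn2real_ennreal enn2real_mono infinity_ennreal_def norm_ge_zero)
      then show ?case by (intro integrable_const_bound) auto
    qed
  next
    case False
    have q: "1 \<le> enn2real p" using p False by (metis enn2real_1 enn2real_mono infinity_ennreal_def less_top)
    have "integrable lborel (\<lambda>x. norm (f x) powr enn2real p)" using f False by (simp add: Lp_space_def)
    from AE_powr_integral_finite[OF fm this] show ?thesis
      by eventually_elim (rule integrable_if_powr_integrable(2)[OF fm q])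
  qed
qed

lemma transition_Lp:
  assumes f: "f \<in> Lp_space p" and p: "1 \<le> p"
  shows "transition f \<in> Lp_space p" and "Lp_norm p (transition f) \<le> Lp_norm p f"
proof -
  have fm [measurable]: "f \<in> borel_measurable borel" using f by (simp add: Lp_space_def)
  have Tm [measurable]: "transition f \<in> borel_measurable borel" by (rule borel_measurable_transition[OF fm])
  have "transition f \<in> Lp_space p \<and> Lp_norm p (transition f) \<le> Lp_norm p f"
  proof (cases "p = \<infinity>")
    case True
    define c where "c = esssup lborel (\<lambda>y. ennreal (norm (f y)))"
    have c: "c < \<infinity>" using f True by (simp add: Lp_space_def c_def)
    have "AE x in lborel. AE y in \<kappa> x. ennreal (norm (f y)) \<le> c"
      using AE_norm_le_esssup[OF fm] by (simp add: c_def)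
    with AE_integrable_kernel[OF f p] have "AE x in lborel. ennreal (norm (transition f x)) \<le> c"
    proof eventually_elim
      case (elim x)
      interpret prob_space "\<kappa> x" by (rule prob_space_kernel)
      have "ennreal (norm (transition f x)) \<le> (\<integral>\<^sup>+y. norm (f y) \<partial>\<kappa> x)"
        unfolding transition_def by (rule integral_norm_bound_ennreal[OF elim(1)])
      also have "\<dots> \<le> (\<integral>\<^sup>+y. c \<partial>\<kappa> x)" by (rule nn_integral_mono_AE[OF elim(2)])
      also have "\<dots> = c" by (simp add: emeasure_space_1)
      finally show ?case .
    qed
    then have "esssup lborel (\<lambda>x. ennreal (norm (transition f x))) \<le> c" by (intro esssup_I) auto
    then show ?thesis
      using c True by (auto simp: Lp_space_def Lp_norm_def c_def intro: le_less_trans enn2real_mono)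
  next
    case False
    define q where "q = enn2real p"
    have q: "1 \<le> q" unfolding q_def using p False by (metis enn2real_1 enn2real_mono infinity_ennreal_def less_top)
    have int: "integrable lborel (\<lambda>x. norm (f x) powr q)" using f False by (simp add: Lp_space_def q_def)
    have "AE x in lborel. ennreal (norm (transition f x) powr q) \<le> (\<integral>\<^sup>+y. ennreal (norm (f y) powr q) \<partial>\<kappa> x)"
      using AE_powr_integral_finite[OF fm int]
    proof eventually_elim
      case (elim x)
      interpret prob_space "\<kappa> x" by (rule prob_space_kernel)
      note intx = integrable_if_powr_integrable[OF fm q elim]
      have "norm (transition f x) powr q \<le> (\<integral>y. norm (f y) \<partial>\<kappa> x) powr q"
        unfolding transition_def using q by (intro powr_mono2 integral_norm_bound) auto
      also have "\<dots> \<le> (\<integral>y. norm (f y) powr q \<partial>\<kappa> x)"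
        using intx by (intro powr_expectation_le q) auto
      finally show ?case
        using nn_integral_eq_integral[OF intx(1)] by (simp add: ennreal_leI)
    qed
    then have "(\<integral>\<^sup>+x. ennreal (norm (transition f x) powr q) \<partial>lborel)
        \<le> (\<integral>\<^sup>+x. \<integral>\<^sup>+y. ennreal (norm (f y) powr q) \<partial>\<kappa> x \<partial>lborel)"
      by (rule nn_integral_mono_AE)
    also have "\<dots> = (\<integral>\<^sup>+x. ennreal (norm (f x) powr q) \<partial>lborel)"
      by (rule nn_integral_kernel) measurable
    finally have le: "(\<integral>\<^sup>+x. ennreal (norm (transition f x) powr q) \<partial>lborel) \<le> (\<integral>\<^sup>+x. ennreal (norm (f x) powr q) \<partial>lborel)" .
    have fin: "(\<integral>\<^sup>+x. ennreal (norm (f x) powr q) \<partial>lborel) < \<infinity>"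
      using int by (simp add: integrable_iff_bounded)
    have intT: "integrable lborel (\<lambda>x. norm (transition f x) powr q)"
      using le_less_trans[OF le fin] by (intro integrableI_nonneg) auto
    have "(\<integral>x. norm (transition f x) powr q \<partial>lborel) \<le> (\<integral>x. norm (f x) powr q \<partial>lborel)"
      using enn2real_mono[OF le] fin by (simp add: integral_eq_nn_integral)
    then have "(\<integral>x. norm (transition f x) powr q \<partial>lborel) powr (1 / q) \<le> (\<integral>x. norm (f x) powr q \<partial>lborel) powr (1 / q)"
      using q by (intro powr_mono2) (auto intro: Bochner_Integration.integral_nonneg)
    then show ?thesis using intT False by (simp add: Lp_space_def Lp_norm_def q_def)
  qed
  then show "transition f \<in> Lp_space p" and "Lp_norm p (transition f) \<le> Lp_norm p f" by auto
qed

theorem Lp_contraction_transition: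
  assumes p: "1 \<le> p"
  shows "Lp_contraction p transition"
  unfolding Lp_contraction_def
proof (intro conjI ballI allI impI)
  fix f g assume f: "f \<in> Lp_space p" and g: "g \<in> Lp_space p"
  have [measurable]: "f \<in> borel_measurable borel" "g \<in> borel_measurable borel"
    using f g by (simp_all add: Lp_space_def)
  show "AE x in lborel. transition f x = transition g x" if "AE x in lborel. f x = g x"
  proof -
    have "AE x in lborel. AE y in \<kappa> x. f y = g y" using that by (intro AE_kernel) measurable
    then show ?thesis
      unfolding transition_def by eventually_elim (intro integral_cong_AE, auto)
  qed
  show "AE x in lborel. transition (\<lambda>y. a * f y + b * g y) x = a * transition f x + b * transition g x" for a b
    using AE_integrable_kernel[OF f p] AE_integrable_kernel[OF g p]
    unfolding transition_def by eventually_elim simp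
qed (use transition_Lp[OF _ p] in auto)

end

section \<open>Monotone convolution with point masses\<close>

lemma cauchy_transform_return: "cauchy_transform (return borel x) z = 1 / (z - of_real x)"
  unfolding cauchy_transform_def by (rule integral_return) auto

lemma F_transform_return: "F_transform (return borel x) z = z - of_real x"
  by (simp add: F_transform_def cauchy_transform_return)

text \<open>The equation \<open>F \<mu> = F \<nu> - x\<close> means \<open>G \<mu> = G \<nu> / (1 - x G \<nu>)\<close>, which a rank-one perturbation of \<open>\<nu>\<close> solves.
  Together with uniqueness this gives the definite description in the definition of \<open>\<rhd>\<close> its meaning.\<close>

lemma monotone_convolution_return:
  assumes "real_distribution \<nu>"
  shows real_distribution_return_convolution: "real_distribution (return borel x \<rhd> \<nu>)"
    and F_transform_return_convolution:
      "z \<notin> \<real> \<Longrightarrow> F_transform (return borel x \<rhd> \<nu>) z = F_transform \<nu> z - of_real x"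
proof -
  interpret \<nu>: real_distribution \<nu> by fact
  obtain \<mu> where \<mu>: "real_distribution \<mu>"
    "\<And>z. z \<notin> \<real> \<Longrightarrow> cauchy_transform \<mu> z = cauchy_transform \<nu> z / (1 - of_real x * cauchy_transform \<nu> z)"
    by (rule \<nu>.rank_one_perturbation) blast
  have "F_transform \<mu> z = F_transform \<nu> z - of_real x" if z: "z \<notin> \<real>" for z
  proof -
    have "cauchy_transform \<nu> z \<noteq> 0" using \<nu>.Im_cauchy_transform_nonzero[OF z] by auto
    then show ?thesis by (simp add: F_transform_def \<mu>(2)[OF z] diff_divide_distrib)
  qed
  with \<mu>(1) have ex: "real_distribution \<mu> \<and>
      (\<forall>z. z \<notin> \<real> \<longrightarrow> F_transform \<mu> z = F_transform (return borel x) (F_transform \<nu> z))"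
    by (simp add: F_transform_return)
  have "\<mu>' = \<mu>" if "real_distribution \<mu>' \<and>
      (\<forall>z. z \<notin> \<real> \<longrightarrow> F_transform \<mu>' z = F_transform (return borel x) (F_transform \<nu> z))" for \<mu>'
  proof (rule real_distribution_eqI_cauchy_transform)
    fix z :: complex assume z: "z \<notin> \<real>"
    have "F_transform \<mu>' z = F_transform \<mu> z" using that ex z by simp
    then show "cauchy_transform \<mu>' z = cauchy_transform \<mu> z" by (simp add: F_transform_def)
  qed (use that \<mu>(1) in auto)
  from theI[where P="\<lambda>\<mu>. real_distribution \<mu> \<and>
      (\<forall>z. z \<notin> \<real> \<longrightarrow> F_transform \<mu> z = F_transform (return borel x) (F_transform \<nu> z))", OF ex this]
  have "real_distribution (return borel x \<rhd> \<nu>) \<and>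
      (\<forall>z. z \<notin> \<real> \<longrightarrow> F_transform (return borel x \<rhd> \<nu>) z = F_transform (return borel x) (F_transform \<nu> z))"
    unfolding monotone_convolution_def .
  then show "real_distribution (return borel x \<rhd> \<nu>)"
    and "z \<notin> \<real> \<Longrightarrow> F_transform (return borel x \<rhd> \<nu>) z = F_transform \<nu> z - of_real x"
    by (simp_all add: F_transform_return)
qed

text \<open>The transform of \<open>\<delta>\<^sub>x \<rhd> \<nu>\<close> at \<open>z\<close> is \<open>1 / (w - x)\<close> with \<open>w = F \<nu> z\<close>: as a function of \<open>x\<close> its imaginary part is
  again a Poisson kernel, now at \<open>w\<close>.\<close>

lemma nn_integral_poisson_kernel_return_convolution:
  assumes \<nu>: "real_distribution \<nu>" and y: "0 < y"
  shows "(\<integral>\<^sup>+t. ennreal (poisson_kernel y s t) \<partial>(return borel x \<rhd> \<nu>)) =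
    ennreal (poisson_kernel (Im (F_transform \<nu> (Complex s y))) (Re (F_transform \<nu> (Complex s y))) x)"
proof -
  interpret \<mu>: real_distribution "return borel x \<rhd> \<nu>" by (rule real_distribution_return_convolution[OF \<nu>])
  define w where "w = F_transform \<nu> (Complex s y)"
  have z: "Complex s y \<notin> \<real>" using y by (simp add: complex_is_Real_iff)
  have "1 / cauchy_transform (return borel x \<rhd> \<nu>) (Complex s y) = w - of_real x"
    using F_transform_return_convolution[OF \<nu> z, of x] by (simp add: F_transform_def w_def)
  then have G: "cauchy_transform (return borel x \<rhd> \<nu>) (Complex s y) = 1 / (w - of_real x)"
    by (metis div_by_1 divide_divide_eq_right mult_1)
  show ?thesis
    unfolding \<mu>.poisson_kernel_eq_Im_cauchy_transform[OF y] G
    using Im_resolvent[of "Re w" "Im w" x] by (simp add: w_def)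
qed

lemma Im_F_transform_pos:
  assumes "real_distribution \<nu>" "0 < Im z"
  shows "0 < Im (F_transform \<nu> z)"
proof -
  interpret real_distribution \<nu> by fact
  have "Im (cauchy_transform \<nu> z) < 0" by (rule Im_cauchy_transform_neg[OF assms(2)])
  then show ?thesis
    by (auto simp: F_transform_def Im_divide intro!: divide_neg_pos add_nonneg_pos)
qed

text \<open>Averaging over \<open>x\<close> gives total mass \<open>1\<close> for the Poisson kernel at \<open>w\<close>, whatever \<open>w\<close> in the upper half plane
  is. So all Poisson integrals of the averaged measure agree with those of the Lebesgue measure.\<close>

lemma lebesgue_invariant_return_convolution:
  assumes \<nu>: "real_distribution \<nu>"
    and meas: "(\<lambda>x. return borel x \<rhd> \<nu>) \<in> borel \<rightarrow>\<^sub>M prob_algebra borel"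
  shows "lebesgue_invariant_kernel (\<lambda>x. return borel x \<rhd> \<nu>)"
proof
  let ?\<kappa> = "\<lambda>x. return borel x \<rhd> \<nu>"
  show "?\<kappa> \<in> borel \<rightarrow>\<^sub>M prob_algebra borel" by fact
  have sub: "?\<kappa> \<in> lborel \<rightarrow>\<^sub>M subprob_algebra borel"
    using measurable_prob_algebraD[OF meas] by (simp cong: measurable_cong_sets)
  have P: "(\<integral>\<^sup>+t. ennreal (poisson_kernel y s t) \<partial>(lborel \<bind> ?\<kappa>)) = 1" if y: "0 < y" for y s
  proof -
    have "(\<lambda>t. ennreal (poisson_kernel y s t)) \<in> borel_measurable borel"
      unfolding poisson_kernel_def by measurable
    from nn_integral_bind[OF this sub]
    have "(\<integral>\<^sup>+t. ennreal (poisson_kernel y s t) \<partial>(lborel \<bind> ?\<kappa>)) =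
      (\<integral>\<^sup>+x. ennreal (poisson_kernel (Im (F_transform \<nu> (Complex s y))) (Re (F_transform \<nu> (Complex s y))) x) \<partial>lborel)"
      by (simp add: nn_integral_poisson_kernel_return_convolution[OF \<nu> y])
    also have "\<dots> = 1"
      using nn_integral_poisson_kernel[OF Im_F_transform_pos[OF \<nu>, of "Complex s y"],
          of "Re (F_transform \<nu> (Complex s y))"] y
      by (simp add: poisson_kernel_commute)
    finally show ?thesis .
  qed
  show "lborel \<bind> ?\<kappa> = lborel"
  proof (rule measure_eqI_poisson)
    show "sets (lborel \<bind> ?\<kappa>) = sets borel" using sets_bind_measurable[OF sub] by simp
    show "(\<integral>\<^sup>+t. ennreal (poisson_kernel y s t) \<partial>(lborel \<bind> ?\<kappa>)) = (\<integral>\<^sup>+t. ennreal (poisson_kernel y s t) \<partial>lborel)"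
      if "0 < y" for s y
      unfolding P[OF that] using nn_integral_poisson_kernel[OF that, of s] by (simp add: poisson_kernel_commute)
    show "(\<integral>\<^sup>+t. ennreal (poisson_kernel 1 0 t) \<partial>(lborel \<bind> ?\<kappa>)) < \<infinity>" using P[of 1 0] by simp
  qed simp
qed

theorem proposition5:
  fixes M :: "('h::complex_hilbert_space \<Rightarrow> 'h) set"
    and \<tau> :: "('h \<Rightarrow> 'h) \<Rightarrow> complex"
    and X Y :: "('h \<times> 'h) set"
    and K :: "(real \<Rightarrow> complex) \<Rightarrow> (real \<Rightarrow> complex)"
    and \<nu> :: "real measure"
    and p :: ennreal
  assumes "wstar_probability_space M \<tau>"
    and "selfadjoint_rv M X" and "selfadjoint_rv M Y"
    and "freely_independent \<tau> X Y"
    and "transition_operator \<tau> X Y K"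
    and "real_distribution \<nu>"
    and "\<And>z. z \<notin> \<real> \<Longrightarrow>
           cauchy_transform (rv_distribution \<tau> (rv_add X Y)) z
             = cauchy_transform (rv_distribution \<tau> X) (F_transform \<nu> z)"
    and "\<And>f x. K f x = (LINT y|(return borel x \<rhd> \<nu>). f y)"
    and "1 \<le> p"
  shows "(\<forall>f\<in>Lp_space p. AE x in lborel. integrable (return borel x \<rhd> \<nu>) f)
         \<and> Lp_contraction p K"
proof -
  let ?\<kappa> = "\<lambda>x. return borel x \<rhd> \<nu>"
  have dist: "real_distribution (?\<kappa> x)" for x
    by (rule real_distribution_return_convolution[OF assms(6)])
  have "?\<kappa> \<in> borel \<rightarrow>\<^sub>M prob_algebra borel"
  proof (rule measurable_prob_algebraI, goal_cases)
    case (1 x)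
    show ?case using dist[of x] by (rule real_distribution.axioms(1))
  next
    case 2
    show ?case
    proof (rule measurable_subprob_algebra)
      show "subprob_space (?\<kappa> x)" for x
        using dist[of x] by (intro prob_space_imp_subprob_space real_distribution.axioms(1))
      show "sets (?\<kappa> x) = sets borel" for x
        using dist[of x] by (rule real_distribution.events_eq_borel)
      fix A :: "real set" assume A: "A \<in> sets borel"
      \<comment> \<open>Measurability of the kernel comes from \<open>K\<close>, which maps bounded Borel functions to such functions.\<close>
      have "bounded_borel (indicator A)"
        using A unfolding bounded_borel_def
        by (auto simp: bounded_iff indicator_def intro!: exI[of _ 1])
      then have "bounded_borel (K (indicator A))"
        using assms(5) by (simp add: transition_operator_def)
      then have [measurable]: "K (indicator A) \<in> borel_measurable borel"
        by (simp add: bounded_borel_def)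
      have "emeasure (?\<kappa> x) A = ennreal (Re (K (indicator A) x))" for x
      proof -
        interpret real_distribution "?\<kappa> x" by (rule dist)
        have "K (indicator A) x = (\<integral>y. indicator A y *\<^sub>R 1 \<partial>?\<kappa> x)"
          unfolding assms(8) by (rule Bochner_Integration.integral_cong) (auto simp: indicator_def)
        also have "\<dots> = of_real (measure (?\<kappa> x) A)"
          using A by (simp add: less_top[symmetric] scaleR_conv_of_real)
        finally show ?thesis by (simp add: emeasure_eq_measure)
      qed
      then show "(\<lambda>x. emeasure (?\<kappa> x) A) \<in> borel_measurable borel" by simp
    qed
  qed
  then interpret lebesgue_invariant_kernel ?\<kappa>
    by (rule lebesgue_invariant_return_convolution[OF assms(6)])
  have "K = transition" by (intro ext) (simp add: assms(8) transition_def)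
  then show ?thesis using Lp_contraction_transition[OF assms(9)] AE_integrable_kernel[OF _ assms(9)] by simp
qed

end
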